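(* Let $n\geq 2$ and for $a>0$ let $D(a)=\{z\in\mathbb{C}^n: ||z_k|^2-|z_n|^2|<(|z_n|^2+1)^{-a}\text{ for } k=1,\ldots,n-1\}$. If $\frac{2}{n-1}<a_1,a_2\leq\frac{3}{n-1}$, then every biholomorphism $F:D(a_1)\to D(a_2)$ is linear. In particular, if $D(a_1)$ and $D(a_2)$ are biholomorphically equivalent, then they are linearly equivalent. *)

theory Defs
  imports "HOL-Analysis.Analysis"
begin

text \<open>Points of C^n are vectors complex ^ 'n, where the finite index type 'n
  carries a linear order; its greatest element plays the role of the index n,
  and the other elements are the indices 1..n-1. The dimension is CARD('n).\<close>

definition last_idx :: "'n::{finite,linorder}" where
  "last_idx = Max (UNIV :: 'n set)"

definition Dom :: "real \<Rightarrow> (complex ^ 'n::{finite,linorder}) set" where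
  "Dom a = {z. \<forall>k. k \<noteq> last_idx \<longrightarrow>
      \<bar>(cmod (z $ k))\<^sup>2 - (cmod (z $ last_idx))\<^sup>2\<bar>
        < ((cmod (z $ last_idx))\<^sup>2 + 1) powr (- a)}"

definition cvec_holomorphic_on ::
  "(complex ^ 'n::finite \<Rightarrow> complex ^ 'm::finite) \<Rightarrow> (complex ^ 'n) set \<Rightarrow> bool" where
  "cvec_holomorphic_on F S \<longleftrightarrow> open S \<and>
     (\<forall>z\<in>S. \<exists>L. (F has_derivative L) (at z) \<and> (\<forall>c v. L (c *s v) = c *s L v))"

definition biholomorphism ::
  "(complex ^ 'n::finite \<Rightarrow> complex ^ 'n) \<Rightarrow> (complex ^ 'n) set \<Rightarrow> (complex ^ 'n) set \<Rightarrow> bool" where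
  "biholomorphism F U V \<longleftrightarrow> cvec_holomorphic_on F U \<and> bij_betw F U V \<and>
     (\<exists>G. cvec_holomorphic_on G V \<and> (\<forall>z\<in>U. G (F z) = z) \<and> (\<forall>w\<in>V. F (G w) = w))"

definition biholomorphically_equivalent :: "(complex ^ 'n::finite) set \<Rightarrow> (complex ^ 'n) set \<Rightarrow> bool" where
  "biholomorphically_equivalent U V \<longleftrightarrow> (\<exists>F. biholomorphism F U V)"

definition linearly_equivalent :: "(complex ^ 'n::finite) set \<Rightarrow> (complex ^ 'n) set \<Rightarrow> bool" where
  "linearly_equivalent U V \<longleftrightarrow> (\<exists>A :: complex ^ 'n ^ 'n. invertible A \<and> (\<lambda>z. A *v z) ` U = V)"

end

(*  A biholomorphism F between the two domains pulls square integrable holomorphic functions back: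
    if f is one, so is (f o F) * det DF.  Both domains contain every line { zeta u } with u in the
    unit torus, and they are so thin along these lines that a square integrable holomorphic function
    restricts to each line as a polynomial in zeta: the bound a <= 3/(n-1) forces degree at most one,
    while a > 2/(n-1) makes 1 and the coordinates square integrable.  So det DF and F_k * det DF are
    affine on each line.  As det DF has no zero, it is constant there, whence F(zeta u) = b + zeta A u.
    This line has to stay in the target domain, which gives b = 0, and F = A follows by the
    identity theorem. *)

theory Submission
  imports Defs "HOL-Complex_Analysis.Conformal_Mappings"
begin

text \<open>Both thresholds come from one integral. Over a fixed last coordinate w, each other
  coordinate ranges over a plane set of area about 2 pi (|w|^2 + 1)^(-a), so the square integral of
  z_n^m over the domain behaves like that of |w|^(2m - 2a(n-1)) near infinity in the plane. It
  diverges for all m \<ge> 2 once a(n-1) \<le> 3, and converges for m \<le> 1 once a(n-1) > 2. The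
  obstacle is that f is no monomial, and that a nonzero coefficient on one line is no information
  about the other lines. Symmetry helps twice: averaging over the circle action isolates the part of
  degree m without increasing the L2 norm, and coordinatewise rotations move a neighbourhood of one
  line over the whole compact torus. The pullback preserves square integrability because the real
  Jacobian of a holomorphic map is |det DF|^2. The change of variables theorem is stated for
  \<open>real^'m\<close> with a wellordered index type, whence the type \<open>cidx\<close> of real
  coordinates. Holomorphy in several variables is only exploited along complex lines, by
  one-variable theory.\<close>

section \<open>Real coordinates of C^n and block determinants\<close>

datatype 'n cidx = ReI 'n | ImI 'n

lemma UNIV_cidx: "(UNIV :: 'n cidx set) = range ReI \<union> range ImI"
proof -
  have "x \<in> range ReI \<union> range ImI" for x :: "'n cidx" by (cases x) auto
  thus ?thesis by auto
qed

instance cidx :: (finite) finite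
  by standard (simp add: UNIV_cidx)

instantiation cidx :: (linorder) linorder
begin

definition less_eq_cidx :: "'a cidx \<Rightarrow> 'a cidx \<Rightarrow> bool" where
  "less_eq_cidx x y = (case x of
      ReI i \<Rightarrow> (case y of ReI j \<Rightarrow> i \<le> j | ImI j \<Rightarrow> True)
    | ImI i \<Rightarrow> (case y of ReI j \<Rightarrow> False | ImI j \<Rightarrow> i \<le> j))"

definition less_cidx :: "'a cidx \<Rightarrow> 'a cidx \<Rightarrow> bool" where
  "less_cidx x y \<longleftrightarrow> x \<le> y \<and> \<not> y \<le> x"

instance
  by standard (auto simp: less_eq_cidx_def less_cidx_def split: cidx.splits)

end

text \<open>The sort demanded by the change of variables theorem. In a finite linear order the
  number of predecessors is a measure for well-founded induction.\<close>

instance cidx :: ("{finite,linorder}") wellorder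
proof
  fix P :: "'a cidx \<Rightarrow> bool" and a
  assume *: "\<And>x. (\<And>y. y < x \<Longrightarrow> P y) \<Longrightarrow> P x"
  show "P a"
  proof (induction a rule: measure_induct_rule[where f = "\<lambda>x. card {y. y < x}"])
    case (less x)
    have "card {z. z < y} < card {z. z < x}" if "y < x" for y
      using that by (intro psubset_card_mono) (auto intro: less_trans)
    thus ?case using * less by blast
  qed
qed

lemma sum_cidx:
  fixes f :: "'n::finite cidx \<Rightarrow> 'a::comm_monoid_add"
  shows "sum f UNIV = (\<Sum>i\<in>UNIV. f (ReI i)) + (\<Sum>i\<in>UNIV. f (ImI i))"
  unfolding UNIV_cidx
  by (subst sum.union_disjoint) (auto simp: sum.reindex inj_on_def)

lemma prod_cidx:
  fixes f :: "'n::finite cidx \<Rightarrow> 'a::comm_monoid_mult"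
  shows "prod f UNIV = (\<Prod>i\<in>UNIV. f (ReI i)) * (\<Prod>i\<in>UNIV. f (ImI i))"
  unfolding UNIV_cidx
  by (subst prod.union_disjoint) (auto simp: prod.reindex inj_on_def)

text \<open>These are the permutations of the 2n real indices that preserve both halves, the only
  ones that contribute to a block triangular determinant.\<close>

definition perm_pair :: "('n \<Rightarrow> 'n) \<Rightarrow> ('n \<Rightarrow> 'n) \<Rightarrow> 'n cidx \<Rightarrow> 'n cidx" where
  "perm_pair p q c = (case c of ReI i \<Rightarrow> ReI (p i) | ImI i \<Rightarrow> ImI (q i))"

lemma perm_pair_simps [simp]:
  "perm_pair p q (ReI i) = ReI (p i)" "perm_pair p q (ImI i) = ImI (q i)"
  by (simp_all add: perm_pair_def)

text \<open>Built up from transpositions: a transposition of indices lifts to a transposition of the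
  real halves, so the sign changes in step.\<close>

lemma sign_perm_pair_left:
  fixes p :: "'n::finite \<Rightarrow> 'n"
  assumes "p permutes UNIV"
  shows "perm_pair p id permutes UNIV \<and> sign (perm_pair p id) = sign p"
  using assms finite[of "UNIV :: 'n set"]
proof (induction rule: permutes_induct)
  case id
  have "perm_pair (id::'n\<Rightarrow>'n) id = id" by (rule ext, case_tac x) simp_all
  then show ?case by (simp only: permutes_id sign_id)
next
  case (swap a b p)
  have eq: "perm_pair (Transposition.transpose a b \<circ> p) id =
      Transposition.transpose (ReI a) (ReI b) \<circ> perm_pair p id"
    by (rule ext, case_tac x) (simp_all add: Transposition.transpose_def)
  have 1: "Transposition.transpose (ReI a) (ReI b) permutes (UNIV :: 'n cidx set)"
    and 2: "Transposition.transpose a b permutes (UNIV :: 'n set)"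
    by (auto intro: permutes_swap_id)
  show ?case
  proof
    have 0: "perm_pair p id permutes UNIV" "p permutes UNIV" "sign (perm_pair p id) = sign p"
      using swap.IH swap.hyps by blast+
    have 3: "permutation (perm_pair p id)" "permutation p"
      by (rule permutes_imp_permutation[OF finite 0(1)] permutes_imp_permutation[OF finite 0(2)])+
    have 4: "permutation (Transposition.transpose (ReI a) (ReI b))" "permutation (Transposition.transpose a b)"
      by (simp_all add: permutation_swap_id)
    show "perm_pair (Transposition.transpose a b \<circ> p) id permutes UNIV"
      unfolding eq by (rule permutes_compose[OF 0(1) 1])
    show "sign (perm_pair (Transposition.transpose a b \<circ> p) id) = sign (Transposition.transpose a b \<circ> p)"
      unfolding eq sign_compose[OF 4(1) 3(1)] sign_compose[OF 4(2) 3(2)]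
      using 0(3) by (simp add: sign_swap_id del: id_apply)
  qed
qed

lemma sign_perm_pair_right:
  fixes p :: "'n::finite \<Rightarrow> 'n"
  assumes "p permutes UNIV"
  shows "perm_pair id p permutes UNIV \<and> sign (perm_pair id p) = sign p"
  using assms finite[of "UNIV :: 'n set"]
proof (induction rule: permutes_induct)
  case id
  have "perm_pair (id::'n\<Rightarrow>'n) id = id" by (rule ext, case_tac x) simp_all
  then show ?case by (simp only: permutes_id sign_id)
next
  case (swap a b p)
  have eq: "perm_pair id (Transposition.transpose a b \<circ> p) =
      Transposition.transpose (ImI a) (ImI b) \<circ> perm_pair id p"
    by (rule ext, case_tac x) (simp_all add: Transposition.transpose_def)
  have 1: "Transposition.transpose (ImI a) (ImI b) permutes (UNIV :: 'n cidx set)"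
    and 2: "Transposition.transpose a b permutes (UNIV :: 'n set)"
    by (auto intro: permutes_swap_id)
  show ?case
  proof
    have 0: "perm_pair id p permutes UNIV" "p permutes UNIV" "sign (perm_pair id p) = sign p"
      using swap.IH swap.hyps by blast+
    have 3: "permutation (perm_pair id p)" "permutation p"
      by (rule permutes_imp_permutation[OF finite 0(1)] permutes_imp_permutation[OF finite 0(2)])+
    have 4: "permutation (Transposition.transpose (ImI a) (ImI b))" "permutation (Transposition.transpose a b)"
      by (simp_all add: permutation_swap_id)
    show "perm_pair id (Transposition.transpose a b \<circ> p) permutes UNIV"
      unfolding eq by (rule permutes_compose[OF 0(1) 1])
    show "sign (perm_pair id (Transposition.transpose a b \<circ> p)) = sign (Transposition.transpose a b \<circ> p)"
      unfolding eq sign_compose[OF 4(1) 3(1)] sign_compose[OF 4(2) 3(2)]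
      using 0(3) by (simp add: sign_swap_id del: id_apply)
  qed
qed

lemma sign_perm_pair:
  fixes p q :: "'n::finite \<Rightarrow> 'n"
  assumes "p permutes UNIV" "q permutes UNIV"
  shows "perm_pair p q permutes UNIV" "sign (perm_pair p q) = sign p * sign q"
proof -
  have eq: "perm_pair p q = perm_pair p id \<circ> perm_pair id q"
    by (rule ext, case_tac x) simp_all
  note L = sign_perm_pair_left[OF assms(1)] and R = sign_perm_pair_right[OF assms(2)]
  show "perm_pair p q permutes UNIV"
    unfolding eq using L R by (intro permutes_compose) blast+
  have "permutation (perm_pair p id)" "permutation (perm_pair id q)"
    using L R permutes_imp_permutation[OF finite] by blast+
  thus "sign (perm_pair p q) = sign p * sign q"
    unfolding eq using L R by (simp add: sign_compose del: id_apply)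
qed

text \<open>In the Leibniz expansion a permutation that sends some \<open>ReI\<close> index to an
  \<open>ImI\<close> index picks up a zero entry. The remaining ones preserve both halves, so they
  are exactly the \<open>perm_pair p q\<close>, and the sum factors.\<close>

lemma det_block_lower_triangular:
  fixes M :: "'a::comm_ring_1^'n::finite cidx^'n cidx"
  assumes "\<And>i j. M $ ReI i $ ImI j = 0"
  shows "det M = det (\<chi> i j. M $ ReI i $ ReI j) * det (\<chi> i j. M $ ImI i $ ImI j)"
proof -
  let ?P = "{p :: 'n \<Rightarrow> 'n. p permutes UNIV}"
  let ?t = "\<lambda>r :: 'n cidx \<Rightarrow> 'n cidx. of_int (sign r) * (\<Prod>c\<in>UNIV. M $ c $ r c)"
  let ?comb = "\<lambda>(p, q). perm_pair p q"
  have inj: "inj_on ?comb (?P \<times> ?P)"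
  proof (rule inj_onI, clarify)
    fix p q p' q' :: "'n \<Rightarrow> 'n" assume *: "perm_pair p q = perm_pair p' q'"
    have "p i = p' i" "q i = q' i" for i
      using fun_cong[OF *, of "ReI i"] fun_cong[OF *, of "ImI i"] by simp_all
    thus "p = p' \<and> q = q'" by blast
  qed
  have sub: "?comb ` (?P \<times> ?P) \<subseteq> {r. r permutes UNIV}"
    using sign_perm_pair(1) by auto
  have zero: "?t r = 0" if r: "r \<in> {r. r permutes UNIV} - ?comb ` (?P \<times> ?P)" for r
  proof (rule ccontr)
    assume "?t r \<noteq> 0"
    have rp: "r permutes UNIV" using r by simp
    have A: "\<exists>j. r (ReI i) = ReI j" for i
    proof (cases "r (ReI i)")
      case (ImI j)
      hence "(\<Prod>c\<in>UNIV. M $ c $ r c) = 0"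
        using assms by (intro prod_zero bexI[of _ "ReI i"]) (auto simp: ImI)
      with \<open>?t r \<noteq> 0\<close> show ?thesis by simp
    qed auto
    then obtain p where p: "\<And>i. r (ReI i) = ReI (p i)" by metis
    have injr: "inj r" using rp by (rule permutes_inj)
    have "inj p"
    proof (rule injI)
      fix x y assume "p x = p y"
      hence "r (ReI x) = r (ReI y)" by (simp add: p)
      thus "x = y" using injr by (simp add: inj_eq)
    qed
    \<comment> \<open>Finiteness makes the real half the full image of itself, so injectivity of
      \<open>r\<close> leaves no room there for an imaginary index.\<close>
    hence sp: "surj p" by (rule finite_UNIV_inj_surj[OF finite])
    have B: "\<exists>j. r (ImI i) = ImI j" for i
    proof (cases "r (ImI i)")
      case (ReI j)
      obtain k where "p k = j" using sp by (metis surjD)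
      hence "r (ReI k) = r (ImI i)" by (simp add: p ReI)
      thus ?thesis using injr by (simp add: inj_eq)
    qed auto
    then obtain q where q: "\<And>i. r (ImI i) = ImI (q i)" by metis
    have "inj q"
    proof (rule injI)
      fix x y assume "q x = q y"
      hence "r (ImI x) = r (ImI y)" by (simp add: q)
      thus "x = y" using injr by (simp add: inj_eq)
    qed
    have "p permutes UNIV" "q permutes UNIV"
      using \<open>inj p\<close> \<open>inj q\<close> by (auto simp: permutes_altdef bij_betw_def finite_UNIV_inj_surj)
    moreover have "r = ?comb (p, q)"
      by (rule ext, case_tac x) (simp_all add: p q)
    ultimately show False using r by blast
  qed
  have "det M = sum ?t {r. r permutes UNIV}" by (simp add: det_def)
  also have "\<dots> = sum ?t (?comb ` (?P \<times> ?P))"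
    by (rule sum.mono_neutral_right) (use sub zero in \<open>auto intro: finite_permutations\<close>)
  also have "\<dots> = (\<Sum>(p, q)\<in>?P \<times> ?P. ?t (perm_pair p q))"
    by (subst sum.reindex[OF inj]) (simp add: case_prod_unfold)
  also have "\<dots> = (\<Sum>(p, q)\<in>?P \<times> ?P.
      (of_int (sign p) * (\<Prod>i\<in>UNIV. M $ ReI i $ ReI (p i))) *
      (of_int (sign q) * (\<Prod>i\<in>UNIV. M $ ImI i $ ImI (q i))))"
    by (rule sum.cong) (auto simp: sign_perm_pair prod_cidx mult_ac)
  also have "\<dots> = det (\<chi> i j. M $ ReI i $ ReI j) * det (\<chi> i j. M $ ImI i $ ImI j)"
    by (simp add: det_def sum_product sum.cartesian_product)
  finally show ?thesis .
qed

definition block_mat ::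
  "'a^'n^'n \<Rightarrow> 'a^'n^'n \<Rightarrow> 'a^'n^'n \<Rightarrow> 'a^'n^'n \<Rightarrow> 'a^'n cidx^'n cidx" where
  "block_mat A B C D = (\<chi> r c. case r of
      ReI i \<Rightarrow> (case c of ReI j \<Rightarrow> A $ i $ j | ImI j \<Rightarrow> B $ i $ j)
    | ImI i \<Rightarrow> (case c of ReI j \<Rightarrow> C $ i $ j | ImI j \<Rightarrow> D $ i $ j))"

lemma block_mat_nth [simp]:
  "block_mat A B C D $ ReI i $ ReI j = A $ i $ j"
  "block_mat A B C D $ ReI i $ ImI j = B $ i $ j"
  "block_mat A B C D $ ImI i $ ReI j = C $ i $ j"
  "block_mat A B C D $ ImI i $ ImI j = D $ i $ j"
  by (simp_all add: block_mat_def)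

lemma cidx_mat_eqI:
  assumes "\<And>i j. X $ ReI i $ ReI j = Y $ ReI i $ ReI j" "\<And>i j. X $ ReI i $ ImI j = Y $ ReI i $ ImI j"
    "\<And>i j. X $ ImI i $ ReI j = Y $ ImI i $ ReI j" "\<And>i j. X $ ImI i $ ImI j = Y $ ImI i $ ImI j"
  shows "X = Y"
  unfolding vec_eq_iff by (metis assms cidx.exhaust)

lemma block_mat_mult:
  fixes A :: "'a::comm_ring_1^'n::finite^'n"
  shows "block_mat A B C D ** block_mat A' B' C' D' =
    block_mat (A ** A' + B ** C') (A ** B' + B ** D') (C ** A' + D ** C') (C ** B' + D ** D')"
  by (rule cidx_mat_eqI) (simp_all add: matrix_matrix_mult_def sum_cidx)

lemma det_block_mat_lower:
  fixes A :: "'a::comm_ring_1^'n::finite^'n"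
  shows "det (block_mat A 0 C D) = det A * det D"
  by (subst det_block_lower_triangular) simp_all

lemma det_block_mat_upper:
  fixes A :: "'a::comm_ring_1^'n::finite^'n"
  shows "det (block_mat A B 0 D) = det A * det D"
proof -
  have "transpose (block_mat A B 0 D) = block_mat (transpose A) 0 (transpose B) (transpose D)"
    by (rule cidx_mat_eqI) (simp_all add: transpose_def)
  thus ?thesis by (metis det_block_mat_lower det_transpose)
qed

text \<open>The matrix of \<open>A\<close> as a real-linear map: the 2 by 2 matrix of multiplication
  by x + iy, with rows (x, -y) and (y, x), inflated to blocks because all real parts come before all
  imaginary parts.\<close>

definition real_mat :: "complex^'n^'n \<Rightarrow> real^'n cidx^'n cidx" where
  "real_mat A = block_mat (\<chi> i j. Re (A $ i $ j)) (\<chi> i j. - Im (A $ i $ j))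
                          (\<chi> i j. Im (A $ i $ j)) (\<chi> i j. Re (A $ i $ j))"

lemma of_real_det: "complex_of_real (det A) = det (\<chi> i j. complex_of_real (A $ i $ j))"
  by (simp add: det_def)

lemma cnj_det: "cnj (det A) = det (\<chi> i j. cnj (A $ i $ j))"
  by (simp add: det_def)

text \<open>Over the complex numbers the real matrix of \<open>A\<close> is conjugate to a block triangular one
  with diagonal blocks \<open>A\<close> and its complex conjugate.\<close>

lemma det_real_mat:
  fixes A :: "complex^'n::finite^'n"
  shows "det (real_mat A) = (cmod (det A))\<^sup>2"
proof -
  let ?R = "(\<chi> i j. of_real (Re (A $ i $ j))) :: complex^'n^'n"
  let ?I = "(\<chi> i j. of_real (Im (A $ i $ j))) :: complex^'n^'n"
  let ?i = "mat \<i> :: complex^'n^'n"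
  let ?U = "block_mat (mat 1) ?i 0 (mat 1)" and ?V = "block_mat (mat 1) (- ?i) 0 (mat 1)"
  let ?M = "block_mat ?R (- ?I) ?I ?R"
  have iI: "?i ** X = (\<chi> r c. \<i> * X $ r $ c)" "X ** ?i = (\<chi> r c. \<i> * X $ r $ c)" for X :: "complex^'n^'n"
    by (simp_all add: matrix_matrix_mult_def mat_def vec_eq_iff if_distrib if_distribR cong: if_cong)
  have iI': "X ** (- ?i) = (\<chi> r c. - (\<i> * X $ r $ c))" for X :: "complex^'n^'n"
    by (simp add: matrix_matrix_mult_def mat_def vec_eq_iff if_distrib if_distribR sum_negf cong: if_cong)
  have "?U ** (?M ** ?V) = block_mat A 0 ?I (\<chi> i j. cnj (A $ i $ j))"
    unfolding block_mat_mult
    by (rule cidx_mat_eqI) (simp_all add: iI iI' algebra_simps complex_eq_iff)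
  moreover have "det ?U = 1" "det ?V = 1" by (simp_all add: det_block_mat_upper)
  moreover have "det (?U ** (?M ** ?V)) = det ?U * (det ?M * det ?V)"
    by (simp only: det_mul)
  ultimately have "det ?M = det A * cnj (det A)"
    by (simp only: det_block_mat_lower mult_1 mult_1_right cnj_det)
  moreover have "(\<chi> i j. of_real (real_mat A $ i $ j)) = ?M"
    by (rule cidx_mat_eqI) (simp_all add: real_mat_def)
  hence "of_real (det (real_mat A)) = det ?M" by (simp only: of_real_det)
  ultimately have "complex_of_real (det (real_mat A)) = complex_of_real ((cmod (det A))\<^sup>2)"
    using complex_norm_square[of "det A"] by simp
  thus ?thesis by (simp only: of_real_eq_iff)
qed

section \<open>Identification of C^n with R^(2n)\<close>

definition to_real :: "complex^'n \<Rightarrow> real^'n cidx" where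
  "to_real z = (\<chi> c. case c of ReI i \<Rightarrow> Re (z $ i) | ImI i \<Rightarrow> Im (z $ i))"

definition of_real_vec :: "real^'n cidx \<Rightarrow> complex^'n" where
  "of_real_vec x = (\<chi> i. Complex (x $ ReI i) (x $ ImI i))"

lemma to_real_nth [simp]: "to_real z $ ReI i = Re (z $ i)" "to_real z $ ImI i = Im (z $ i)"
  by (simp_all add: to_real_def)

lemma of_real_vec_to_real [simp]: "of_real_vec (to_real z) = z"
  by (simp add: of_real_vec_def vec_eq_iff)

lemma cidx_vec_eqI:
  assumes "\<And>i. x $ ReI i = y $ ReI i" "\<And>i. x $ ImI i = y $ ImI i"
  shows "x = y"
  unfolding vec_eq_iff by (metis assms cidx.exhaust)

lemma to_real_of_real_vec [simp]: "to_real (of_real_vec x) = x"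
  by (rule cidx_vec_eqI) (simp_all add: of_real_vec_def)

lemma to_real_mult: "to_real (A *v z) = real_mat A *v to_real (z :: complex^'n::finite)"
  by (rule cidx_vec_eqI)
     (simp_all add: matrix_vector_mult_def real_mat_def sum_cidx Re_sum Im_sum sum.distrib sum_subtractf sum_negf)

lemma linear_to_real: "linear (to_real :: complex^'n::finite \<Rightarrow> _)"
  by (intro linearI cidx_vec_eqI) simp_all

lemma linear_of_real_vec: "linear (of_real_vec :: real^'n::finite cidx \<Rightarrow> _)"
  by (intro linearI) (simp_all add: of_real_vec_def vec_eq_iff complex_eq_iff)

lemma bounded_linear_to_real: "bounded_linear (to_real :: complex^'n::finite \<Rightarrow> _)"
  using linear_to_real by (rule linear_conv_bounded_linear[THEN iffD1])

lemma bounded_linear_of_real_vec: "bounded_linear (of_real_vec :: real^'n::finite cidx \<Rightarrow> _)"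
  using linear_of_real_vec by (rule linear_conv_bounded_linear[THEN iffD1])

section \<open>Change of variables for nonnegative integrals\<close>

text \<open>An upper bound is all that the finiteness arguments need, and it is trivial when the
  right side is infinite. Otherwise \<open>h\<close> is absolutely integrable on the image, which is
  the setting of the change of variables theorem for Lebesgue integrals.\<close>

lemma nn_change_of_variables_real:
  fixes g :: "real^'m::{finite,wellorder} \<Rightarrow> real^'m::_" and h :: "real^'m::_ \<Rightarrow> real"
  assumes S: "open S" and gS: "open (g ` S)" and inj: "inj_on g S"
    and der: "\<And>x. x \<in> S \<Longrightarrow> (g has_derivative g' x) (at x)"
    and h [measurable]: "h \<in> borel_measurable borel" and h0: "\<And>x. 0 \<le> h x"
  shows "(\<integral>\<^sup>+x. indicator S x * ennreal (\<bar>det (matrix (g' x))\<bar> * h (g x)) \<partial>lborel)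
    \<le> (\<integral>\<^sup>+y. indicator (g ` S) y * ennreal (h y) \<partial>lborel)" (is "_ \<le> ?R")
proof (cases "?R = \<infinity>")
  case False
  then obtain r where r: "0 \<le> r" "?R = ennreal r" by (cases ?R) auto
  have [measurable]: "g ` S \<in> sets borel" using gS by simp
  have "?R = (\<integral>\<^sup>+y. ennreal (indicator (g ` S) y * h y) \<partial>lborel)"
    by (intro nn_integral_cong) (auto simp: indicator_def)
  hence "((\<lambda>y. indicator (g ` S) y * h y) has_integral r) UNIV"
    using r h0 by (intro nn_integral_has_integral) auto
  also have "(\<lambda>y. indicator (g ` S) y * h y) = (\<lambda>y. if y \<in> g ` S then h y else 0)"
    by (auto simp: indicator_def)
  finally have hr: "(h has_integral r) (g ` S)"
    by (subst (asm) has_integral_restrict_UNIV)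
  have abs: "h absolutely_integrable_on (g ` S)"
    using hr h0 by (intro nonnegative_absolutely_integrable_1) auto
  let ?d = "\<lambda>x. \<bar>det (matrix (g' x))\<bar>"
  \<comment> \<open>The theorem to be applied concerns integrands with values in
    \<open>real^'n\<close>, so \<open>h\<close> is viewed as a vector of length one.\<close>
  have "(\<lambda>y. vec (h y) :: real^1) absolutely_integrable_on (g ` S) \<and>
      integral (g ` S) (\<lambda>y. vec (h y) :: real^1) = vec r"
    using abs hr unfolding absolutely_integrable_on_1_iff
    by (auto simp: integral_on_1_eq has_integral_iff o_def)
  hence *: "(\<lambda>x. ?d x *\<^sub>R vec (h (g x)) :: real^1) absolutely_integrable_on S \<and>
      integral S (\<lambda>x. ?d x *\<^sub>R vec (h (g x)) :: real^1) = vec r"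
    using S by (subst has_absolute_integral_change_of_variables[OF _ has_derivative_at_withinI[OF der] inj])
               auto
  hence "(\<lambda>x. ?d x * h (g x)) integrable_on S \<and> integral S (\<lambda>x. ?d x * h (g x)) = r"
    unfolding absolutely_integrable_on_1_iff
    by (auto simp: integral_on_1_eq o_def set_lebesgue_integral_eq_integral(1) vec_eq_iff)
  hence "((\<lambda>x. ?d x * h (g x)) has_integral r) S" by (simp add: has_integral_iff)
  hence "(\<integral>\<^sup>+x. indicator S x * ennreal (?d x * h (g x)) \<partial>lborel) = ennreal r"
    using h0 nn_integral_has_integral_lebesgue[of S "\<lambda>x. ?d x * h (g x)" r]
    by (simp add: ennreal_mult'' ennreal_indicator[symmetric] ennreal_mult)
  thus ?thesis using r by simp
qed simp

lemma prod_Basis_vec: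
  fixes f :: "'a::euclidean_space^'n::finite \<Rightarrow> 'b::comm_monoid_mult"
  shows "(\<Prod>b\<in>Basis. f b) = (\<Prod>i\<in>UNIV. \<Prod>b\<in>Basis. f (axis i b))"
proof -
  have eq: "(Basis :: ('a^'n) set) = (\<lambda>(i, b). axis i b) ` (UNIV \<times> Basis)"
    by (auto simp: Basis_vec_def)
  have "inj_on (\<lambda>(i, b). axis i b :: 'a^'n) (UNIV \<times> Basis)"
    by (auto simp: inj_on_def axis_eq_axis)
  thus ?thesis unfolding eq
    by (subst prod.reindex) (auto simp: prod.cartesian_product case_prod_unfold)
qed

text \<open>Both measures give a box its volume, which characterises Lebesgue measure. The product
  form allows Fubini to separate the last coordinate from the others.\<close>

lemma lborel_vec_eq_PiM:
  "(lborel :: ('a::euclidean_space^'n::finite) measure) =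
    distr (\<Pi>\<^sub>M i\<in>UNIV. lborel) borel (\<lambda>f. \<chi> i. f i)"
proof (rule lborel_eqI)
  interpret product_sigma_finite "\<lambda>_::'n. lborel :: 'a measure" by standard
  have m [measurable]: "(\<lambda>f. \<chi> i. f i) \<in> (\<Pi>\<^sub>M i\<in>UNIV. lborel) \<rightarrow>\<^sub>M (borel :: ('a^'n) measure)"
    by (subst borel_measurable_euclidean_space) (auto simp: Basis_vec_def inner_axis)
  fix l u :: "'a^'n" assume le: "\<And>b. b \<in> Basis \<Longrightarrow> l \<bullet> b \<le> u \<bullet> b"
  have le': "l $ i \<bullet> b \<le> u $ i \<bullet> b" if "b \<in> Basis" for i b
    using le[of "axis i b"] that by (auto simp: Basis_vec_def inner_axis)
  have "emeasure (distr (\<Pi>\<^sub>M i\<in>UNIV. lborel) borel (\<lambda>f. \<chi> i. f i)) (box l u) =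
      emeasure (\<Pi>\<^sub>M i\<in>UNIV. lborel) (\<Pi>\<^sub>E i\<in>UNIV. box (l $ i) (u $ i))"
  proof (subst emeasure_distr)
    show "box l u \<in> sets borel" by simp
    show "emeasure (\<Pi>\<^sub>M i\<in>UNIV. lborel) ((\<lambda>f. \<chi> i. f i) -` box l u \<inter> space (\<Pi>\<^sub>M i\<in>UNIV. lborel)) =
        emeasure (\<Pi>\<^sub>M i\<in>UNIV. lborel) (\<Pi>\<^sub>E i\<in>UNIV. box (l $ i) (u $ i))"
      by (intro arg_cong2[where f = emeasure])
         (auto simp: box_def Basis_vec_def inner_axis space_PiM)
  qed simp
  also have "\<dots> = (\<Prod>i\<in>UNIV. ennreal (\<Prod>b\<in>Basis. (u $ i - l $ i) \<bullet> b))"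
    by (subst emeasure_PiM) (auto simp: le')
  also have "\<dots> = ennreal (\<Prod>b\<in>Basis. (u - l) \<bullet> b)"
    by (subst prod_ennreal) (auto simp: prod_Basis_vec inner_axis intro!: prod_nonneg simp: le' inner_diff_left)
  finally show "emeasure (distr (\<Pi>\<^sub>M i\<in>UNIV. lborel) borel (\<lambda>f. \<chi> i. f i)) (box l u) =
      ennreal (\<Prod>b\<in>Basis. (u - l) \<bullet> b)" .
qed simp

text \<open>Boxes correspond to boxes of the same volume under \<open>to_real\<close>, so integrals
  move between C^n and R^(2n) without a factor.\<close>

lemma lborel_eq_distr_to_real:
  "(lborel :: (real^'n::finite cidx) measure) = distr lborel borel to_real"
proof (rule lborel_eqI)
  have m [measurable]: "(to_real :: complex^'n \<Rightarrow> _) \<in> borel_measurable borel"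
    by (intro borel_measurable_continuous_onI bounded_linear.continuous_on[OF bounded_linear_to_real] continuous_on_id)
  fix l u :: "real^'n cidx" assume le: "\<And>b. b \<in> Basis \<Longrightarrow> l \<bullet> b \<le> u \<bullet> b"
  have le': "l $ c \<le> u $ c" for c
    using le[of "axis c 1"] by (auto simp: Basis_vec_def inner_axis)
  have pre: "to_real -` box l u = box (of_real_vec l) (of_real_vec u)"
  proof -
    have "x \<in> box l u \<longleftrightarrow> (\<forall>i. l $ ReI i < x $ ReI i \<and> x $ ReI i < u $ ReI i) \<and>
        (\<forall>i. l $ ImI i < x $ ImI i \<and> x $ ImI i < u $ ImI i)" for x
      unfolding mem_box_cart by (metis cidx.exhaust)
    moreover have "z \<in> box (of_real_vec l) (of_real_vec u) \<longleftrightarrow>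
        (\<forall>i. l $ ReI i < Re (z $ i) \<and> Re (z $ i) < u $ ReI i) \<and>
        (\<forall>i. l $ ImI i < Im (z $ i) \<and> Im (z $ i) < u $ ImI i)" for z
      unfolding mem_box by (auto simp: Basis_vec_def inner_axis of_real_vec_def Basis_complex_def)
    ultimately show ?thesis by auto
  qed
  have "emeasure (distr lborel borel to_real) (box l u) = emeasure lborel (box (of_real_vec l) (of_real_vec u))"
    by (subst emeasure_distr) (auto simp: pre)
  also have "\<dots> = ennreal (\<Prod>b\<in>Basis. (of_real_vec u - of_real_vec l) \<bullet> b)"
    using le' by (subst emeasure_lborel_box) (auto simp: Basis_vec_def inner_axis of_real_vec_def Basis_complex_def)
  also have "(\<Prod>b\<in>Basis. (of_real_vec u - of_real_vec l) \<bullet> b) =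
      (\<Prod>i\<in>UNIV. (u $ ReI i - l $ ReI i) * (u $ ImI i - l $ ImI i))"
    by (simp add: prod_Basis_vec inner_axis of_real_vec_def Basis_complex_def)
  also have "\<dots> = (\<Prod>b\<in>Basis. (u - l) \<bullet> b)"
    by (simp add: prod_Basis_vec inner_axis prod_cidx prod.distrib)
  finally show "emeasure (distr lborel borel to_real) (box l u) = ennreal (\<Prod>b\<in>Basis. (u - l) \<bullet> b)" .
qed simp

text \<open>The real version read through \<open>to_real\<close>. By \<open>det_real_mat\<close> the
  Jacobian factor becomes the squared modulus of the complex determinant; for h = |f|^2 the left
  integrand is therefore the squared modulus of the pullback of f.\<close>

lemma nn_change_of_variables_complex:
  fixes F :: "complex^'n::{finite,linorder} \<Rightarrow> complex^'n::_" and h :: "complex^'n::_ \<Rightarrow> real"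
  assumes S: "open S" and FS: "open (F ` S)" and inj: "inj_on F S"
    and der: "\<And>z. z \<in> S \<Longrightarrow> (F has_derivative (\<lambda>v. A z *v v)) (at z)"
    and h [measurable]: "h \<in> borel_measurable borel" and h0: "\<And>x. 0 \<le> h x"
    and meas [measurable]: "(\<lambda>z. indicator S z * ennreal ((cmod (det (A z)))\<^sup>2 * h (F z))) \<in> borel_measurable borel"
  shows "(\<integral>\<^sup>+z. indicator S z * ennreal ((cmod (det (A z)))\<^sup>2 * h (F z)) \<partial>lborel)
    \<le> (\<integral>\<^sup>+w. indicator (F ` S) w * ennreal (h w) \<partial>lborel)"
proof -
  let ?g = "\<lambda>x. to_real (F (of_real_vec x))"
  let ?S = "of_real_vec -` S" and ?T = "of_real_vec -` (F ` S)"
  have cR: "continuous_on UNIV (to_real :: complex^'n::_ \<Rightarrow> _)"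
    and cC: "continuous_on UNIV (of_real_vec :: real^'n::_ cidx \<Rightarrow> _)"
    by (intro bounded_linear.continuous_on[OF bounded_linear_to_real] continuous_on_id
        bounded_linear.continuous_on[OF bounded_linear_of_real_vec])+
  have [measurable]: "(to_real :: complex^'n::_ \<Rightarrow> _) \<in> borel_measurable borel"
      "(of_real_vec :: real^'n::_ cidx \<Rightarrow> _) \<in> borel_measurable borel"
    using cR cC by (auto intro: borel_measurable_continuous_onI)
  have S': "open ?S" "open ?T"
    by (auto intro!: open_vimage S FS cC)
  have img: "?g ` ?S = ?T"
  proof
    show "?T \<subseteq> ?g ` ?S"
    proof
      fix x assume "x \<in> ?T"
      then obtain z where z: "z \<in> S" "of_real_vec x = F z" by auto
      hence "x = ?g (to_real z)" by (metis of_real_vec_to_real to_real_of_real_vec)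
      thus "x \<in> ?g ` ?S" by (rule image_eqI) (use z in simp)
    qed
  qed auto
  have inj': "inj_on ?g ?S"
  proof (rule inj_onI)
    fix x y assume "x \<in> ?S" "y \<in> ?S" "?g x = ?g y"
    hence "F (of_real_vec x) = F (of_real_vec y)" by (metis of_real_vec_to_real)
    hence "of_real_vec x = of_real_vec y" using \<open>x \<in> ?S\<close> \<open>y \<in> ?S\<close> inj by (auto dest: inj_onD)
    thus "x = y" by (metis to_real_of_real_vec)
  qed
  have der': "(?g has_derivative ((*v) (real_mat (A (of_real_vec x))))) (at x)" if "x \<in> ?S" for x
  proof -
    have "(?g has_derivative (\<lambda>v. to_real (A (of_real_vec x) *v of_real_vec v))) (at x)"
      using that
      by (intro bounded_linear.has_derivative[OF bounded_linear_to_real]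
          has_derivative_compose[OF bounded_linear_imp_has_derivative[OF bounded_linear_of_real_vec] der]) auto
    thus ?thesis by (simp add: to_real_mult)
  qed
  have "(\<integral>\<^sup>+z. indicator S z * ennreal ((cmod (det (A z)))\<^sup>2 * h (F z)) \<partial>lborel) =
      (\<integral>\<^sup>+x. indicator ?S x * ennreal (\<bar>det (matrix ((*v) (real_mat (A (of_real_vec x)))))\<bar> *
        h (of_real_vec (?g x))) \<partial>lborel)"
  proof -
    have "(\<lambda>x. indicator S (of_real_vec x) * ennreal ((cmod (det (A (of_real_vec x))))\<^sup>2 * h (F (of_real_vec x)))) 
        \<in> borel_measurable (borel :: (real^'n::_ cidx) measure)"
      using measurable_compose[OF _ meas] by measurable
    thus ?thesis
      unfolding lborel_eq_distr_to_real
      by (subst nn_integral_distr) (auto simp: det_real_mat indicator_def intro!: nn_integral_cong)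
  qed
  also have "\<dots> \<le> (\<integral>\<^sup>+x. indicator (?g ` ?S) x * ennreal (h (of_real_vec x)) \<partial>lborel)"
    using S' by (intro nn_change_of_variables_real[OF _ _ inj' der']) (auto simp: img h0)
  also have "\<dots> = (\<integral>\<^sup>+w. indicator (F ` S) w * ennreal (h w) \<partial>lborel)"
  proof -
    have [measurable]: "?T \<in> sets borel" using S' by simp
    have "(\<lambda>x. indicator ?T x * ennreal (h (of_real_vec x))) \<in> borel_measurable borel"
      by measurable
    thus ?thesis
      unfolding img lborel_eq_distr_to_real
      by (subst nn_integral_distr) (auto intro!: nn_integral_cong simp: indicator_def)
  qed
  finally show ?thesis .
qed

section \<open>Two integrals over the plane, and the area of an annulus\<close>

lemma emeasure_ball_complex:
  "r \<ge> 0 \<Longrightarrow> emeasure lborel (ball (0::complex) r) = ennreal (pi * r\<^sup>2)"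
  "r \<ge> 0 \<Longrightarrow> emeasure lborel (cball (0::complex) r) = ennreal (pi * r\<^sup>2)"
  by (simp_all add: emeasure_ball emeasure_cball unit_ball_vol_2)

text \<open>Dyadic comparison: where |w| is between 2^j and 2^(j+1), the integrand is at most
  4^(-js), and the disc of radius 2^(j+1) has area 4 pi 4^j. Replacing shells by discs only enlarges
  the bound, which is a geometric series.\<close>

lemma nn_integral_powr_finite:
  assumes "s > 1"
  shows "(\<integral>\<^sup>+w. ennreal (((cmod w)\<^sup>2 + 1) powr (- s)) \<partial>lborel) < \<infinity>"
proof -
  have le_suminf: "f j \<le> (\<Sum>j. f j)" for f :: "nat \<Rightarrow> ennreal" and j
  proof -
    have "sum f {j} \<le> suminf f" by (intro sum_le_suminf summableI) auto
    thus ?thesis by simp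
  qed
  \<comment> \<open>The ratio of that series: 4 from the growth of the area, 4^(-s) from the decay
    of the integrand. It is below 1 because s > 1.\<close>
  define q where "q = 4 powr (1 - s)"
  have q: "0 < q" "q < 1"
    using assms powr_less_mono[of "1 - s" 0 4] by (auto simp: q_def)
  have "(\<integral>\<^sup>+w. ennreal (((cmod w)\<^sup>2 + 1) powr (- s)) \<partial>lborel) \<le>
      (\<integral>\<^sup>+w. (\<Sum>j. ennreal ((4 ^ j) powr (- s)) * indicator (ball (0::complex) (2 ^ Suc j)) w) \<partial>lborel)"
  proof (intro nn_integral_mono)
    fix w :: complex
    have "\<exists>j. cmod w < 2 ^ Suc j"
      using real_arch_pow[of 2 "cmod w"] by (metis less_trans one_less_numeral_iff power_strict_increasing_iff lessI semiring_norm(76))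
    \<comment> \<open>Minimality of j gives the lower bound 2^j \<le> |w|, except for j = 0, where
      the summand 1 of |w|^2 + 1 takes over.\<close>
    then obtain j where j: "cmod w < 2 ^ Suc j" "\<And>i. i < j \<Longrightarrow> \<not> cmod w < 2 ^ Suc i"
      using exists_least_iff[of "\<lambda>j. cmod w < 2 ^ Suc j"] by blast
    have "4 ^ j \<le> (cmod w)\<^sup>2 + 1"
    proof (cases j)
      case (Suc i)
      hence "2 ^ j \<le> cmod w" using j(2)[of i] by simp
      hence "(2 ^ j)\<^sup>2 \<le> (cmod w)\<^sup>2" by (intro power_mono) auto
      thus ?thesis by (simp add: power2_eq_square power_mult_distrib[symmetric])
    qed simp
    hence "((cmod w)\<^sup>2 + 1) powr (- s) \<le> (4 ^ j) powr (- s)"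
      using assms by (intro powr_mono2') auto
    hence "ennreal (((cmod w)\<^sup>2 + 1) powr (- s)) \<le>
        ennreal ((4 ^ j) powr (- s)) * indicator (ball (0::complex) (2 ^ Suc j)) w"
      using j(1) by (auto simp: indicator_def intro!: ennreal_leI)
    also have "\<dots> \<le> (\<Sum>j. ennreal ((4 ^ j) powr (- s)) * indicator (ball (0::complex) (2 ^ Suc j)) w)"
      by (rule le_suminf)
    finally show "ennreal (((cmod w)\<^sup>2 + 1) powr (- s)) \<le> \<dots>" .
  qed
  also have "\<dots> = (\<Sum>j. \<integral>\<^sup>+w. ennreal ((4 ^ j) powr (- s)) * indicator (ball (0::complex) (2 ^ Suc j)) w \<partial>lborel)"
    by (rule nn_integral_suminf) (intro borel_measurable_times_ennreal borel_measurable_const borel_measurable_indicator, simp)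
  also have "\<dots> = (\<Sum>j. ennreal ((4 ^ j) powr (- s)) * ennreal (pi * (2 ^ Suc j)\<^sup>2))"
    by (intro suminf_cong)
       (simp only: nn_integral_cmult_indicator sets_lborel borel_open open_ball
         emeasure_ball_complex zero_le_power zero_le_numeral)
  also have "\<dots> = (\<Sum>j. ennreal (4 * pi * q ^ j))"
  proof (intro suminf_cong)
    fix j :: nat
    have "(2 ^ Suc j)\<^sup>2 = 4 * (4::real) ^ j"
      by (simp add: power2_eq_square power_mult_distrib[symmetric])
    moreover have "(4::real) ^ j * (4 ^ j) powr (- s) = q ^ j"
    proof -
      have "(4::real) ^ j * (4 ^ j) powr (- s) = (4 ^ j) powr (1 - s)"
        by (simp add: powr_diff powr_minus divide_simps)
      also have "\<dots> = q ^ j"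
        by (simp add: q_def powr_realpow[symmetric] powr_powr mult.commute)
      finally show ?thesis .
    qed
    ultimately have "(4 ^ j) powr (- s) * (pi * (2 ^ Suc j)\<^sup>2) = 4 * pi * q ^ j" by (simp add: mult_ac)
    thus "ennreal ((4 ^ j) powr (- s)) * ennreal (pi * (2 ^ Suc j)\<^sup>2) = ennreal (4 * pi * q ^ j)"
      by (simp only: ennreal_mult[symmetric] powr_ge_zero zero_le_power2 pi_ge_zero mult_nonneg_nonneg)
  qed
  also have "\<dots> = ennreal (\<Sum>j. 4 * pi * q ^ j)"
    using q by (intro suminf_ennreal2 summable_mult summable_geometric) auto
  also have "\<dots> < \<infinity>" by simp
  finally show ?thesis .
qed

text \<open>The borderline exponent: the shell between R 2^j and R 2^(j+1) has area 3 pi R^2 4^j,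
  and the integrand there is at least 1 / (R 2^(j+1))^2, so every shell contributes at least the
  same amount 3 pi / 4.\<close>

lemma nn_integral_inverse_square_infinite:
  assumes "R > 0"
  shows "(\<integral>\<^sup>+w. indicator {w. R < cmod w} w * ennreal (1 / (cmod w)\<^sup>2) \<partial>lborel) = \<infinity>"
proof -
  define A where "A j = cball (0::complex) (R * 2 ^ Suc j) - cball 0 (R * 2 ^ j)" for j :: nat
  have A_disj: "disjoint_family A"
  proof -
    have "A i \<inter> A j = {}" if "i < j" for i j
    proof -
      have "R * 2 ^ Suc i \<le> R * 2 ^ j"
        using that assms by (intro mult_left_mono power_increasing) auto
      thus ?thesis by (force simp: A_def)
    qed
    thus ?thesis unfolding disjoint_family_on_def by (metis Int_commute linorder_neqE_nat)
  qed
  have A_sets [measurable]: "A j \<in> sets borel" for j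
    unfolding A_def by measurable
  have em: "emeasure lborel (A j) = ennreal (3 * pi * R\<^sup>2 * 4 ^ j)" for j
  proof -
    have "R * 2 ^ j \<le> R * 2 ^ Suc j"
      using assms by (intro mult_left_mono power_increasing) auto
    hence "cball (0::complex) (R * 2 ^ j) \<subseteq> cball 0 (R * 2 ^ Suc j)"
      by (rule subset_cball)
    moreover have em: "emeasure lborel (cball (0::complex) (R * 2 ^ i)) = ennreal (pi * (R * 2 ^ i)\<^sup>2)" for i
      using assms by (intro emeasure_ball_complex) simp
    ultimately have "emeasure lborel (A j) = ennreal (pi * (R * 2 ^ Suc j)\<^sup>2) - ennreal (pi * (R * 2 ^ j)\<^sup>2)"
      unfolding A_def by (subst emeasure_Diff) (simp_all only: em sets_lborel cball_def[symmetric] borel_closed closed_cball ennreal_neq_top infinity_ennreal_def not_False_eq_True)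
    also have "\<dots> = ennreal (pi * (R * 2 ^ Suc j)\<^sup>2 - pi * (R * 2 ^ j)\<^sup>2)"
      by (simp add: ennreal_minus)
    also have "pi * (R * 2 ^ Suc j)\<^sup>2 - pi * (R * 2 ^ j)\<^sup>2 = 3 * pi * R\<^sup>2 * 4 ^ j"
    proof -
      have "(4::real) ^ j = 2 ^ j * 2 ^ j" by (simp add: power_mult_distrib[symmetric])
      thus ?thesis by (simp add: power2_eq_square algebra_simps)
    qed
    finally show ?thesis .
  qed
  have "\<infinity> = (\<Sum>j::nat. ennreal (3 * pi / 4))"
  proof (rule ccontr)
    assume "\<infinity> \<noteq> (\<Sum>j::nat. ennreal (3 * pi / 4))"
    hence "summable (\<lambda>j::nat. 3 * pi / 4)"
      by (intro summable_suminf_not_top) auto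
    thus False by (simp add: summable_const_iff)
  qed
  also have "(\<Sum>j::nat. ennreal (3 * pi / 4)) = (\<Sum>j. ennreal (1 / (R * 2 ^ Suc j)\<^sup>2) * emeasure lborel (A j))"
  proof (intro suminf_cong)
    fix j :: nat
    have "1 / (R * 2 ^ Suc j)\<^sup>2 * (3 * pi * R\<^sup>2 * 4 ^ j) = 3 * pi / 4"
      using assms by (simp add: field_simps power2_eq_square power_mult_distrib[symmetric])
    thus "ennreal (3 * pi / 4) = ennreal (1 / (R * 2 ^ Suc j)\<^sup>2) * emeasure lborel (A j)"
      unfolding em using assms by (subst ennreal_mult[symmetric]) (auto simp: mult_ac)
  qed
  also have "\<dots> = (\<Sum>j. \<integral>\<^sup>+w. ennreal (1 / (R * 2 ^ Suc j)\<^sup>2) * indicator (A j) w \<partial>lborel)"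
    by (intro suminf_cong nn_integral_cmult_indicator[symmetric], simp add: A_sets)
  also have "\<dots> = (\<integral>\<^sup>+w. (\<Sum>j. ennreal (1 / (R * 2 ^ Suc j)\<^sup>2) * indicator (A j) w) \<partial>lborel)"
    by (rule nn_integral_suminf[symmetric]) (intro borel_measurable_times_ennreal borel_measurable_const borel_measurable_indicator, simp add: A_sets)
  also have "\<dots> \<le> (\<integral>\<^sup>+w. indicator {w. R < cmod w} w * ennreal (1 / (cmod w)\<^sup>2) \<partial>lborel)"
  proof (intro nn_integral_mono)
    fix w :: complex
    show "(\<Sum>j. ennreal (1 / (R * 2 ^ Suc j)\<^sup>2) * indicator (A j) w) \<le>
      indicator {w. R < cmod w} w * ennreal (1 / (cmod w)\<^sup>2)"
    proof (cases "\<exists>j. w \<in> A j")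
      case True
      then obtain j where j: "w \<in> A j" by blast
      have "R * 1 \<le> R * 2 ^ j" using assms by (intro mult_left_mono) auto
      hence w: "R < cmod w" "cmod w \<le> R * 2 ^ Suc j" using j by (auto simp: A_def)
      have "(\<Sum>j. ennreal (1 / (R * 2 ^ Suc j)\<^sup>2) * indicator (A j) w) = ennreal (1 / (R * 2 ^ Suc j)\<^sup>2)"
        by (rule suminf_cmult_indicator[OF A_disj j])
      also have "\<dots> \<le> ennreal (1 / (cmod w)\<^sup>2)"
        using w assms by (intro ennreal_leI divide_left_mono power_mono mult_pos_pos zero_less_power) auto
      finally show ?thesis using w by simp
    qed auto
  qed
  finally show ?thesis by (simp add: top_unique)
qed

text \<open>The range of each of the other coordinates of a point of \<open>Dom a\<close> whose last
  coordinate is \<open>w\<close>. For small |w| it degenerates to a disc about 0.\<close>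

definition annulus :: "real \<Rightarrow> complex \<Rightarrow> complex set" where
  "annulus a w = {v. \<bar>(cmod v)\<^sup>2 - (cmod w)\<^sup>2\<bar> < ((cmod w)\<^sup>2 + 1) powr (- a)}"

lemma sq_norm_plus_1_pos: "0 < (cmod w)\<^sup>2 + 1"
  by (smt (verit) zero_le_power2)

text \<open>With s = |w|^2, the squared radii are s - \<rho> and s + \<rho>, so the area is 2 pi
  \<rho> as long as \<rho> \<le> s. Otherwise the set is a disc of area pi (s + \<rho>), which is
  smaller than 2 pi \<rho>. For |w| \<ge> 1 and a \<ge> 0 one has \<rho> \<le> 1 \<le> s.\<close>

lemma emeasure_annulus_le:
  "emeasure lborel (annulus a w) \<le> ennreal (2 * pi * ((cmod w)\<^sup>2 + 1) powr (- a))"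
  and emeasure_annulus_eq:
  "a \<ge> 0 \<Longrightarrow> cmod w \<ge> 1 \<Longrightarrow>
    emeasure lborel (annulus a w) = ennreal (2 * pi * ((cmod w)\<^sup>2 + 1) powr (- a))"
proof -
  define \<rho> where "\<rho> = ((cmod w)\<^sup>2 + 1) powr (- a)"
  define s where "s = (cmod w)\<^sup>2"
  have "(cmod w)\<^sup>2 + 1 > 0" by (rule sq_norm_plus_1_pos)
  hence \<rho>: "\<rho> > 0" by (simp add: \<rho>_def)
  have s: "s \<ge> 0" by (simp add: s_def)
  have ann: "annulus a w = {v. \<bar>(cmod v)\<^sup>2 - s\<bar> < \<rho>}"
    by (simp add: annulus_def s_def \<rho>_def)
  have sq: "cmod v < sqrt t \<longleftrightarrow> (cmod v)\<^sup>2 < t" "cmod v \<le> sqrt t \<longleftrightarrow> (cmod v)\<^sup>2 \<le> t" if "t \<ge> 0" for v t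
    using that by (metis norm_ge_zero real_sqrt_less_iff real_sqrt_unique, metis norm_ge_zero real_sqrt_le_iff real_sqrt_unique)
  have eq: "emeasure lborel (annulus a w) = ennreal (2 * pi * \<rho>)" if "\<rho> \<le> s"
  proof -
    have "annulus a w = ball 0 (sqrt (s + \<rho>)) - cball 0 (sqrt (s - \<rho>))"
      unfolding ann using that \<rho> s by (auto simp: sq)
    also have "emeasure lborel \<dots> = ennreal (pi * (s + \<rho>)) - ennreal (pi * (s - \<rho>))"
    proof (subst emeasure_Diff)
      show "cball 0 (sqrt (s - \<rho>)) \<subseteq> ball (0::complex) (sqrt (s + \<rho>))"
        using real_sqrt_less_mono[of "s - \<rho>" "s + \<rho>"] \<rho> by (auto simp del: real_sqrt_less_iff)
    qed (use \<rho> s that in \<open>auto simp: emeasure_ball_complex\<close>)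
    also have "\<dots> = ennreal (2 * pi * \<rho>)"
      using that by (subst ennreal_minus) (auto simp: algebra_simps)
    finally show ?thesis .
  qed
  have "emeasure lborel (annulus a w) \<le> ennreal (2 * pi * \<rho>)"
  proof (cases "\<rho> \<le> s")
    case False
    have "annulus a w \<subseteq> ball 0 (sqrt (s + \<rho>))"
      unfolding ann using \<rho> s by (auto simp: sq)
    hence "emeasure lborel (annulus a w) \<le> emeasure lborel (ball (0::complex) (sqrt (s + \<rho>)))"
      by (intro emeasure_mono) auto
    also have "\<dots> = ennreal (pi * (s + \<rho>))" using \<rho> s by (simp add: emeasure_ball_complex)
    also have "\<dots> \<le> ennreal (pi * (2 * \<rho>))" using False by (intro ennreal_leI mult_left_mono) auto
    finally show ?thesis by (simp add: mult_ac)
  qed (simp add: eq)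
  thus "emeasure lborel (annulus a w) \<le> ennreal (2 * pi * ((cmod w)\<^sup>2 + 1) powr (- a))"
    by (simp add: \<rho>_def)
  assume "a \<ge> 0" "cmod w \<ge> 1"
  have "\<rho> \<le> ((cmod w)\<^sup>2 + 1) powr 0"
    unfolding \<rho>_def using \<open>a \<ge> 0\<close> by (intro powr_mono) auto
  also have "\<dots> = 1" using \<open>(cmod w)\<^sup>2 + 1 > 0\<close> by simp
  also have "1 \<le> s" unfolding s_def using \<open>cmod w \<ge> 1\<close> by simp
  finally show "emeasure lborel (annulus a w) = ennreal (2 * pi * ((cmod w)\<^sup>2 + 1) powr (- a))"
    using eq by (simp add: \<rho>_def)
qed

section \<open>Integrals over the domain\<close>

lemma open_Dom: "open (Dom a :: (complex^'n::{finite,linorder}) set)"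
proof -
  have "Dom a = (\<Inter>k\<in>UNIV - {last_idx}. {z::complex^'n::_. \<bar>(cmod (z $ k))\<^sup>2 - (cmod (z $ last_idx))\<^sup>2\<bar>
        < ((cmod (z $ last_idx))\<^sup>2 + 1) powr (- a)})"
    by (auto simp: Dom_def)
  also have "open \<dots>"
    by (intro open_INT ballI finite open_Collect_less continuous_intros)
       (use sq_norm_plus_1_pos in \<open>auto simp: less_imp_neq[symmetric]\<close>)
  finally show ?thesis .
qed

text \<open>Once the last coordinate is fixed, the others vary independently in the same annulus, so
  Fubini produces the power n - 1 of its area.\<close>

lemma nn_integral_Dom:
  fixes h :: "complex \<Rightarrow> ennreal"
  assumes [measurable]: "h \<in> borel_measurable borel"
  shows "(\<integral>\<^sup>+z. indicator (Dom a :: (complex^'n::{finite,linorder}) set) z * h (z $ last_idx) \<partial>lborel) =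
    (\<integral>\<^sup>+w. h w * emeasure lborel (annulus a w) ^ (CARD('n) - 1) \<partial>lborel)"
proof -
  interpret product_sigma_finite "\<lambda>_::'n. lborel :: complex measure" by standard
  let ?l = "last_idx :: 'n" and ?I = "UNIV - {last_idx :: 'n}"
  have [measurable]: "(\<lambda>f. \<chi> i. f i) \<in> (\<Pi>\<^sub>M i\<in>UNIV. lborel) \<rightarrow>\<^sub>M (borel :: (complex^'n::_) measure)"
    by (subst borel_measurable_euclidean_space) (auto simp: Basis_vec_def inner_axis)
  have [measurable]: "(\<lambda>z::complex^'n::_. z $ i) \<in> borel_measurable borel" for i
    by (intro borel_measurable_continuous_onI continuous_intros)
  have [measurable]: "(Dom a :: (complex^'n::_) set) \<in> sets borel" by (rule borel_open[OF open_Dom])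
  have ins: "(UNIV :: 'n set) = insert ?l ?I" by auto
  have [measurable]: "annulus a w \<in> sets borel" for w
    unfolding annulus_def by measurable
  have "(\<integral>\<^sup>+z. indicator (Dom a :: (complex^'n::_) set) z * h (z $ last_idx) \<partial>lborel) =
      (\<integral>\<^sup>+f. indicator (Dom a) (\<chi> i. f i) * h (f ?l) \<partial>(\<Pi>\<^sub>M i\<in>UNIV. lborel))"
    unfolding lborel_vec_eq_PiM by (subst nn_integral_distr) auto
  also have "\<dots> = (\<integral>\<^sup>+f. indicator (Dom a) (\<chi> i. f i) * h (f ?l) \<partial>(\<Pi>\<^sub>M i\<in>insert ?l ?I. lborel))"
    by (simp flip: ins)
  also have "\<dots> = (\<integral>\<^sup>+w. \<integral>\<^sup>+f. indicator (Dom a) (\<chi> i. (f(?l := w)) i) * h w \<partial>(\<Pi>\<^sub>M i\<in>?I. lborel) \<partial>lborel)"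
    by (subst product_nn_integral_insert_rev) (auto simp flip: ins)
  also have "\<dots> = (\<integral>\<^sup>+w. \<integral>\<^sup>+f. h w * indicator (\<Pi>\<^sub>E i\<in>?I. annulus a w) f \<partial>(\<Pi>\<^sub>M i\<in>?I. lborel) \<partial>lborel)"
  proof (intro nn_integral_cong)
    fix w :: complex and f :: "'n \<Rightarrow> complex" assume "f \<in> space (\<Pi>\<^sub>M i\<in>?I. lborel :: complex measure)"
    hence "(\<chi> i. (f(?l := w)) i) \<in> Dom a \<longleftrightarrow> f \<in> (\<Pi>\<^sub>E i\<in>?I. annulus a w)"
      by (auto simp: Dom_def annulus_def space_PiM PiE_def Pi_def)
    thus "indicator (Dom a) (\<chi> i. (f(?l := w)) i) * h w = h w * indicator (\<Pi>\<^sub>E i\<in>?I. annulus a w) f"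
      by (simp add: indicator_def)
  qed
  also have "\<dots> = (\<integral>\<^sup>+w. h w * emeasure lborel (annulus a w) ^ (CARD('n) - 1) \<partial>lborel)"
  proof (intro nn_integral_cong)
    fix w :: complex
    have "(\<integral>\<^sup>+f. h w * indicator (\<Pi>\<^sub>E i\<in>?I. annulus a w) f \<partial>(\<Pi>\<^sub>M i\<in>?I. lborel)) =
        h w * emeasure (\<Pi>\<^sub>M i\<in>?I. lborel) (\<Pi>\<^sub>E i\<in>?I. annulus a w)"
      by (intro nn_integral_cmult_indicator sets_PiM_I_finite) auto
    also have "emeasure (\<Pi>\<^sub>M i\<in>?I. lborel) (\<Pi>\<^sub>E i\<in>?I. annulus a w) = emeasure lborel (annulus a w) ^ (CARD('n) - 1)"
      by (subst emeasure_PiM) (auto simp: card_Diff_singleton)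
    finally show "(\<integral>\<^sup>+f. h w * indicator (\<Pi>\<^sub>E i\<in>?I. annulus a w) f \<partial>(\<Pi>\<^sub>M i\<in>?I. lborel)) =
      h w * emeasure lborel (annulus a w) ^ (CARD('n) - 1)" .
  qed
  finally show ?thesis .
qed

text \<open>The exponent left over from the weight and the n - 1 annuli is 1 - a(n-1), and it is
  below -1 exactly under the lower bound on \<open>a\<close>. The weight |z_n|^2 + 1 is chosen to
  dominate the constant 1 and all |z_k|^2 on the domain at once.\<close>

lemma nn_integral_Dom_finite:
  assumes n2: "CARD('n::{finite,linorder}) \<ge> 2" and a: "2 / (real CARD('n) - 1) < a"
  shows "(\<integral>\<^sup>+z. indicator (Dom a :: (complex^'n::_) set) z *
      ennreal ((cmod (z $ last_idx))\<^sup>2 + 1) \<partial>lborel) < \<infinity>"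
proof -
  let ?N = "CARD('n) - 1"
  have N: "real ?N = real CARD('n) - 1" "real ?N > 0" using n2 by auto
  have s: "a * real ?N - 1 > 1" using a N by (simp add: field_simps)
  let ?s = "a * real ?N - 1"
  have "(\<integral>\<^sup>+z. indicator (Dom a :: (complex^'n::_) set) z * ennreal ((cmod (z $ last_idx))\<^sup>2 + 1) \<partial>lborel) =
      (\<integral>\<^sup>+w. ennreal ((cmod w)\<^sup>2 + 1) * emeasure lborel (annulus a w) ^ ?N \<partial>lborel)"
    by (rule nn_integral_Dom) measurable
  also have "\<dots> \<le> (\<integral>\<^sup>+w. ennreal ((2 * pi) ^ ?N) * ennreal (((cmod w)\<^sup>2 + 1) powr (- ?s)) \<partial>lborel)"
  proof (intro nn_integral_mono)
    fix w :: complex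
    let ?t = "(cmod w)\<^sup>2 + 1"
    have t: "?t > 0" by (rule sq_norm_plus_1_pos)
    have "ennreal ?t * emeasure lborel (annulus a w) ^ ?N \<le> ennreal ?t * ennreal (2 * pi * ?t powr (- a)) ^ ?N"
      by (intro mult_left_mono power_mono emeasure_annulus_le) auto
    also have "\<dots> = ennreal (?t * (2 * pi * ?t powr (- a)) ^ ?N)"
      by (subst ennreal_power, simp, rule ennreal_mult[symmetric]) (use t in auto)
    also have "?t * (2 * pi * ?t powr (- a)) ^ ?N = (2 * pi) ^ ?N * (?t * (?t powr (- a)) ^ ?N)"
      by (simp add: power_mult_distrib)
    also have "?t * (?t powr (- a)) ^ ?N = ?t powr (- ?s)"
    proof -
      have "(?t powr (- a)) ^ ?N = ?t powr (- a * real ?N)"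
        using t by (simp add: powr_realpow[symmetric] powr_powr)
      hence "?t * (?t powr (- a)) ^ ?N = ?t powr 1 * ?t powr (- a * real ?N)" using t by simp
      also have "\<dots> = ?t powr (- ?s)" by (subst powr_add[symmetric]) (simp add: algebra_simps)
      finally show ?thesis .
    qed
    finally show "ennreal ?t * emeasure lborel (annulus a w) ^ ?N \<le>
        ennreal ((2 * pi) ^ ?N) * ennreal (?t powr (- ?s))"
      by (simp add: ennreal_mult)
  qed
  also have "\<dots> = ennreal ((2 * pi) ^ ?N) * (\<integral>\<^sup>+w. ennreal (((cmod w)\<^sup>2 + 1) powr (- ?s)) \<partial>lborel)"
    by (rule nn_integral_cmult) measurable
  also have "\<dots> < \<infinity>"
    using nn_integral_powr_finite[OF s] by (simp add: ennreal_mult_less_top)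
  finally show ?thesis .
qed

text \<open>For |w| \<ge> 1 the factor |w|^(2m) is at least |w|^4, and by a(n-1) \<le> 3 the annuli
  contribute at least a multiple of |w|^(-6). What remains is the divergent integral of |w|^(-2).
  The cut at \<open>R\<close> is there because the covering by cones will only be available far
  out.\<close>

lemma nn_integral_Dom_infinite:
  assumes n2: "CARD('n::{finite,linorder}) \<ge> 2" and a: "0 < a" "a \<le> 3 / (real CARD('n) - 1)"
    and m: "m \<ge> 2" and R: "R \<ge> 1"
  shows "(\<integral>\<^sup>+z. indicator (Dom a \<inter> {z :: complex^'n::_. R < cmod (z $ last_idx)}) z *
      ennreal (cmod (z $ last_idx) ^ (2 * m)) \<partial>lborel) = \<infinity>"
proof -
  let ?N = "CARD('n) - 1"
  have N: "real ?N = real CARD('n) - 1" "real ?N > 0" using n2 by auto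
  have aN: "a * real ?N \<le> 3" using a N by (simp add: field_simps)
  \<comment> \<open>The 8 is 2^3, from the estimate |w|^2 + 1 \<le> 2 |w|^2 raised to the third
    power.\<close>
  let ?c = "(2 * pi) ^ ?N / 8"
  have "\<infinity> = ennreal ?c * (\<integral>\<^sup>+w. indicator {w. R < cmod w} w * ennreal (1 / (cmod w)\<^sup>2) \<partial>lborel)"
    using R by (simp add: nn_integral_inverse_square_infinite ennreal_mult_top)
  also have "\<dots> = (\<integral>\<^sup>+w. ennreal ?c * (indicator {w. R < cmod w} w * ennreal (1 / (cmod w)\<^sup>2)) \<partial>lborel)"
    by (rule nn_integral_cmult[symmetric]) measurable
  also have "\<dots> \<le> (\<integral>\<^sup>+w. (indicator {w. R < cmod w} w * ennreal (cmod w ^ (2 * m))) *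
      emeasure lborel (annulus a w) ^ ?N \<partial>lborel)"
  proof (intro nn_integral_mono)
    fix w :: complex
    show "ennreal ?c * (indicator {w. R < cmod w} w * ennreal (1 / (cmod w)\<^sup>2)) \<le>
      (indicator {w. R < cmod w} w * ennreal (cmod w ^ (2 * m))) * emeasure lborel (annulus a w) ^ ?N"
    proof (cases "R < cmod w")
      case True
      hence w: "cmod w \<ge> 1" using R by simp
      let ?t = "(cmod w)\<^sup>2 + 1"
      have t: "?t \<ge> 1" "?t \<le> 2 * (cmod w)\<^sup>2" using w by auto
      have "?c * (1 / (cmod w)\<^sup>2) = (2 * pi) ^ ?N * (cmod w ^ 4 * (1 / (2 * (cmod w)\<^sup>2) ^ 3))"
        using w by (simp add: field_simps power_numeral_reduce)
      also have "\<dots> \<le> (2 * pi) ^ ?N * (cmod w ^ (2 * m) * (?t powr (- a)) ^ ?N)"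
      proof (intro mult_left_mono mult_mono)
        show "cmod w ^ 4 \<le> cmod w ^ (2 * m)" using w m by (intro power_increasing) auto
        have "1 / (2 * (cmod w)\<^sup>2) ^ 3 \<le> 1 / ?t ^ 3"
          using t w sq_norm_plus_1_pos by (intro divide_left_mono power_mono mult_pos_pos zero_less_power) auto
        also have "\<dots> = ?t powr (- 3)" using t by (simp add: powr_minus powr_numeral divide_simps)
        also have "\<dots> \<le> ?t powr (- a * real ?N)" using t aN by (intro powr_mono) auto
        also have "\<dots> = (?t powr (- a)) ^ ?N"
          using t by (simp add: powr_realpow[symmetric] powr_powr)
        finally show "1 / (2 * (cmod w)\<^sup>2) ^ 3 \<le> (?t powr (- a)) ^ ?N" .
      qed auto
      finally have le: "?c * (1 / (cmod w)\<^sup>2) \<le> cmod w ^ (2 * m) * (2 * pi * ?t powr (- a)) ^ ?N"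
        by (simp add: power_mult_distrib mult_ac)
      have "ennreal ?c * ennreal (1 / (cmod w)\<^sup>2) = ennreal (?c * (1 / (cmod w)\<^sup>2))"
        by (rule ennreal_mult[symmetric]) auto
      also have "\<dots> \<le> ennreal (cmod w ^ (2 * m) * (2 * pi * ?t powr (- a)) ^ ?N)"
        using le by (rule ennreal_leI)
      also have "\<dots> = ennreal (cmod w ^ (2 * m)) * ennreal (2 * pi * ?t powr (- a)) ^ ?N"
        by (subst ennreal_power, simp, rule ennreal_mult) auto
      finally show ?thesis
        using True w a emeasure_annulus_eq[of a w] by simp
    qed simp
  qed
  also have "\<dots> = (\<integral>\<^sup>+z. indicator (Dom a :: (complex^'n::_) set) z *
      (indicator {w. R < cmod w} (z $ last_idx) * ennreal (cmod (z $ last_idx) ^ (2 * m))) \<partial>lborel)"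
    by (rule nn_integral_Dom[symmetric]) measurable
  also have "\<dots> = (\<integral>\<^sup>+z. indicator (Dom a \<inter> {z :: complex^'n::_. R < cmod (z $ last_idx)}) z *
      ennreal (cmod (z $ last_idx) ^ (2 * m)) \<partial>lborel)"
    by (intro nn_integral_cong) (auto simp: indicator_def)
  finally show ?thesis by (simp add: top_unique)
qed

section \<open>Symmetries of the domain\<close>

definition torus :: "(complex^'n) set" where
  "torus = {u. \<forall>i. cmod (u $ i) = 1}"

definition rot :: "complex^'n \<Rightarrow> complex^'n \<Rightarrow> complex^'n" where
  "rot u z = (\<chi> i. u $ i * z $ i)"

lemma rot_nth [simp]: "rot u z $ i = u $ i * z $ i"
  by (simp add: rot_def)

lemma rot_in_Dom_iff: "u \<in> torus \<Longrightarrow> rot u z \<in> Dom a \<longleftrightarrow> z \<in> Dom a"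
  by (simp add: Dom_def torus_def norm_mult)

lemma rot_cnj: "u \<in> torus \<Longrightarrow> rot u (rot (\<chi> i. cnj (u $ i)) z) = z"
  by (simp add: vec_eq_iff torus_def complex_norm_square[symmetric] mult.assoc[symmetric])

lemma scaleR_eq_smult: "r *\<^sub>R v = complex_of_real r *s v"
  by (simp add: vec_eq_iff scaleR_conv_of_real[where 'a = complex])

text \<open>Shrinking multiplies the left side of each defining inequality by r^2 \<le> 1, while the
  right side, decreasing in |z_n|, does not drop.\<close>

lemma Dom_scaleR:
  fixes z :: "complex^'n::{finite,linorder}"
  assumes a: "a > 0" and z: "z \<in> Dom a" and r: "0 \<le> r" "r \<le> 1"
  shows "r *\<^sub>R z \<in> Dom a"
proof (cases "r = 0")
  case True
  thus ?thesis by (simp add: Dom_def)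
next
  case False
  let ?l = "last_idx :: 'n"
  have "\<bar>(cmod ((r *\<^sub>R z) $ k))\<^sup>2 - (cmod ((r *\<^sub>R z) $ ?l))\<^sup>2\<bar> < ((cmod ((r *\<^sub>R z) $ ?l))\<^sup>2 + 1) powr (- a)"
    if k: "k \<noteq> ?l" for k
  proof -
    have r2: "0 < r\<^sup>2" "r\<^sup>2 \<le> 1" using r False by (auto simp: power_le_one)
    have "\<bar>(cmod ((r *\<^sub>R z) $ k))\<^sup>2 - (cmod ((r *\<^sub>R z) $ ?l))\<^sup>2\<bar> =
        r\<^sup>2 * \<bar>(cmod (z $ k))\<^sup>2 - (cmod (z $ ?l))\<^sup>2\<bar>"
      using r2 by (simp add: power_mult_distrib right_diff_distrib[symmetric] abs_mult)
    also have "\<dots> < r\<^sup>2 * ((cmod (z $ ?l))\<^sup>2 + 1) powr (- a)"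
      using z k r2 by (intro mult_strict_left_mono) (auto simp: Dom_def)
    also have "\<dots> \<le> 1 * ((cmod (z $ ?l))\<^sup>2 + 1) powr (- a)"
      using r2 by (intro mult_right_mono) auto
    also have "\<dots> \<le> 1 * ((cmod ((r *\<^sub>R z) $ ?l))\<^sup>2 + 1) powr (- a)"
    proof (intro mult_left_mono powr_mono2')
      have "r\<^sup>2 * (cmod (z $ ?l))\<^sup>2 \<le> 1 * (cmod (z $ ?l))\<^sup>2"
        using r2 by (intro mult_right_mono) auto
      thus "(cmod ((r *\<^sub>R z) $ ?l))\<^sup>2 + 1 \<le> (cmod (z $ ?l))\<^sup>2 + 1"
        using r by (simp add: power_mult_distrib)
      show "0 < (cmod ((r *\<^sub>R z) $ ?l))\<^sup>2 + 1" by (rule sq_norm_plus_1_pos)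
    qed (use a in auto)
    finally show ?thesis by simp
  qed
  thus ?thesis by (simp add: Dom_def)
qed

lemma Dom_smult_unit: "cmod c = 1 \<Longrightarrow> c *s z \<in> Dom a \<longleftrightarrow> z \<in> Dom a"
  by (simp add: Dom_def norm_mult)

text \<open>The domain is balanced: a complex line through 0 meets it in a disc about 0 or lies in
  it entirely. This makes Cauchy's formula on circles about 0 available on every such line.\<close>

lemma Dom_smult:
  fixes z :: "complex^'n::{finite,linorder}"
  assumes "a > 0" "z \<in> Dom a" "cmod c \<le> 1"
  shows "c *s z \<in> Dom a"
proof -
  have "c *s z \<in> Dom a \<longleftrightarrow> cmod c *\<^sub>R z \<in> Dom a"
    by (simp add: Dom_def norm_mult)
  thus ?thesis using Dom_scaleR[OF assms(1,2), of "cmod c"] assms(3) by simp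
qed

lemma continuous_on_smult [continuous_intros]:
  fixes g :: "'a::topological_space \<Rightarrow> complex^'n::finite"
  assumes "continuous_on S f" "continuous_on S g"
  shows "continuous_on S (\<lambda>x. f x *s g x)"
  unfolding vector_scalar_mult_def
  by (intro continuous_on_vec_lambda continuous_intros assms)

lemma borel_measurable_rot [measurable]:
  "rot u \<in> borel_measurable (borel :: (complex^'n::finite) measure)"
  unfolding rot_def
  by (intro borel_measurable_continuous_onI continuous_on_vec_lambda continuous_intros)

lemma borel_measurable_vec_nth_complex [measurable]:
  "(\<lambda>z::complex^'n::finite. z $ i) \<in> borel_measurable borel"
  by (intro borel_measurable_continuous_onI continuous_intros)

lemma Dom_sets [measurable]: "(Dom a :: (complex^'n::{finite,linorder}) set) \<in> sets borel"
  by (rule borel_open[OF open_Dom])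

text \<open>\<open>rot u\<close> is a diagonal matrix with determinant of modulus 1, and it maps the
  domain onto itself.\<close>

lemma nn_integral_rot_le:
  fixes h :: "complex^'n::{finite,linorder} \<Rightarrow> real"
  assumes u: "u \<in> torus" and h [measurable]: "h \<in> borel_measurable borel" and h0: "\<And>z. 0 \<le> h z"
  shows "(\<integral>\<^sup>+z. indicator (Dom a) z * ennreal (h (rot u z)) \<partial>lborel)
    \<le> (\<integral>\<^sup>+z. indicator (Dom a) z * ennreal (h z) \<partial>lborel)"
proof -
  let ?A = "(\<chi> i j. if i = j then u $ i else 0) :: complex^'n::_^'n::_"
  let ?D = "Dom a :: (complex^'n::_) set"
  have A: "rot u = (*v) ?A"
    by (simp add: fun_eq_iff vec_eq_iff matrix_vector_mult_def if_distribR if_distrib cong: if_cong)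
  have "det ?A = (\<Prod>i\<in>UNIV. u $ i)" by (subst det_diagonal) auto
  hence det: "cmod (det ?A) = 1" using u by (simp add: prod_norm[symmetric] torus_def)
  have img: "rot u ` ?D = ?D"
  proof
    show "?D \<subseteq> rot u ` ?D"
    proof
      fix z assume z: "z \<in> ?D"
      let ?v = "(\<chi> i. cnj (u $ i))"
      have "z = rot u (rot ?v z)" using rot_cnj[OF u] by simp
      moreover have "rot ?v z \<in> ?D" using z u rot_in_Dom_iff[of ?v z a] by (simp add: torus_def)
      ultimately show "z \<in> rot u ` ?D" by blast
    qed
  qed (use rot_in_Dom_iff[OF u] in auto)
  have inj: "inj_on (rot u) ?D"
    using u by (auto simp: inj_on_def vec_eq_iff torus_def) (metis norm_zero zero_neq_one)
  have "(\<integral>\<^sup>+z. indicator ?D z * ennreal ((cmod (det ?A))\<^sup>2 * h (rot u z)) \<partial>lborel)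
    \<le> (\<integral>\<^sup>+z. indicator (rot u ` ?D) z * ennreal (h z) \<partial>lborel)"
  proof (rule nn_change_of_variables_complex[where A = "\<lambda>_. ?A"])
    show "(rot u has_derivative (\<lambda>v. ?A *v v)) (at z)" for z
      unfolding A by (rule bounded_linear_imp_has_derivative) (simp add: matrix_vector_mul_bounded_linear)
  qed (use open_Dom inj h0 in \<open>auto simp: img\<close>)
  thus ?thesis by (simp add: det img)
qed

section \<open>Homogeneous Taylor parts and their L2 norm\<close>

text \<open>The homogeneous part of degree m of f, that is, the coefficient of \<zeta>^m in
  f(\<zeta> z), written as a Fourier coefficient over the unit circle. In this form both its
  continuity in z and its L2 bound are visible.\<close>

definition taylor_part :: "(complex^'n \<Rightarrow> complex) \<Rightarrow> nat \<Rightarrow> complex^'n \<Rightarrow> complex" where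
  "taylor_part f m z =
    integral {0..1} (\<lambda>t. f (exp (2 * of_real pi * \<i> * of_real t) *s z) / exp (2 * of_real pi * \<i> * of_real t) ^ m)"

lemma norm_exp_circle: "cmod (exp (2 * of_real pi * \<i> * of_real t)) = 1"
  by (simp add: norm_exp_eq_Re)

lemma continuous_on_circle_map:
  fixes f :: "complex^'n::{finite,linorder} \<Rightarrow> complex"
  assumes "continuous_on (Dom a) f"
  shows "continuous_on (Dom a \<times> T) (\<lambda>(z, t). f (exp (2 * of_real pi * \<i> * of_real t) *s z))"
proof -
  have "continuous_on (Dom a \<times> T) (\<lambda>x. f (exp (2 * of_real pi * \<i> * of_real (snd x)) *s fst x))"
    by (rule continuous_on_compose2[OF assms])
       (auto intro!: continuous_intros simp: Dom_smult_unit norm_exp_circle)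
  thus ?thesis by (simp add: case_prod_unfold)
qed

lemma continuous_on_circle:
  fixes f :: "complex^'n::{finite,linorder} \<Rightarrow> complex"
  assumes "continuous_on (Dom a) f" "z \<in> Dom a"
  shows "continuous_on T (\<lambda>t. f (exp (2 * of_real pi * \<i> * of_real t) *s z))"
  by (rule continuous_on_compose2[OF assms(1)])
     (auto intro!: continuous_intros simp: Dom_smult_unit norm_exp_circle assms(2))

lemma continuous_on_taylor_part:
  fixes f :: "complex^'n::{finite,linorder} \<Rightarrow> complex"
  assumes "continuous_on (Dom a) f"
  shows "continuous_on (Dom a) (taylor_part f m)"
proof -
  have "continuous_on (Dom a \<times> cbox 0 1) (\<lambda>(z, t). f (exp (2 * of_real pi * \<i> * of_real t) *s z) /
      exp (2 * of_real pi * \<i> * of_real t) ^ m)"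
    using continuous_on_circle_map[OF assms, of "cbox 0 1"]
    by (auto simp: case_prod_unfold intro!: continuous_intros)
  from integral_continuous_on_param[OF this] show ?thesis
    by (simp add: taylor_part_def[abs_def])
qed

text \<open>Cauchy's formula on the circle of radius r, whose disc stays in the balanced domain.
  Taking r = 1 identifies the integral with the Taylor coefficient; general r then expresses
  homogeneity of degree m.\<close>

lemma taylor_part_scaleR:
  fixes f :: "complex^'n::{finite,linorder} \<Rightarrow> complex"
  assumes a: "a > 0" and hol: "(\<lambda>\<zeta>. f (\<zeta> *s v)) holomorphic_on {\<zeta>. \<zeta> *s v \<in> Dom a}"
    and r: "r > 0" "r *\<^sub>R v \<in> Dom a"
  shows "taylor_part f m (r *\<^sub>R v) = of_real r ^ m * ((deriv ^^ m) (\<lambda>\<zeta>. f (\<zeta> *s v)) 0 / fact m)"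
proof -
  let ?g = "\<lambda>\<zeta>. f (\<zeta> *s v)"
  let ?e = "\<lambda>t. exp (2 * of_real pi * \<i> * of_real t)"
  have sub: "cball 0 r \<subseteq> {\<zeta>. \<zeta> *s v \<in> Dom a}"
  proof
    fix \<zeta> :: complex assume "\<zeta> \<in> cball 0 r"
    hence "cmod (\<zeta> / of_real r) \<le> 1" using r by (simp add: norm_divide divide_simps)
    from Dom_smult[OF a r(2) this] have "(\<zeta> / of_real r) *s (r *\<^sub>R v) \<in> Dom a" .
    also have "(\<zeta> / of_real r) *s (r *\<^sub>R v) = \<zeta> *s v"
      using r by (simp add: vec_eq_iff scaleR_eq_smult)
    finally show "\<zeta> \<in> {\<zeta>. \<zeta> *s v \<in> Dom a}" by simp
  qed
  have "contour_integral (circlepath 0 r) (\<lambda>u. ?g u / (u - 0) ^ Suc m) =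
      (2 * of_real pi * \<i>) / fact m * (deriv ^^ m) ?g 0"
  proof -
    have "continuous_on (cball 0 r) ?g" "?g holomorphic_on ball 0 r"
      using hol sub ball_subset_cball
      by (blast intro: holomorphic_on_imp_continuous_on holomorphic_on_subset)+
    from Cauchy_contour_integral_circlepath[OF this, of 0 m] show ?thesis using r by simp
  qed
  also have "contour_integral (circlepath 0 r) (\<lambda>u. ?g u / (u - 0) ^ Suc m) =
      integral {0..1} (\<lambda>t. (2 * of_real pi * \<i> / of_real r ^ m) * (f (?e t *s (r *\<^sub>R v)) / ?e t ^ m))"
    unfolding contour_integral_integral
  proof (intro integral_cong)
    fix t :: real assume t: "t \<in> {0..1}"
    have "circlepath 0 r t = of_real r * ?e t" by (simp add: circlepath)
    moreover have "vector_derivative (circlepath 0 r) (at t) = 2 * of_real pi * \<i> * of_real r * ?e t"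
      by (simp add: vector_derivative_circlepath)
    moreover have "(of_real r * ?e t) *s v = ?e t *s (r *\<^sub>R v)"
      by (simp add: vec_eq_iff scaleR_eq_smult)
    ultimately show "?g (circlepath 0 r t) / (circlepath 0 r t - 0) ^ Suc m *
        vector_derivative (circlepath 0 r) (at t) =
        (2 * of_real pi * \<i> / of_real r ^ m) * (f (?e t *s (r *\<^sub>R v)) / ?e t ^ m)"
      using r by (simp add: power_mult_distrib field_simps)
  qed
  also have "\<dots> = (2 * of_real pi * \<i> / of_real r ^ m) * taylor_part f m (r *\<^sub>R v)"
    unfolding taylor_part_def by (rule integral_mult_right)
  finally show ?thesis using r by (simp add: field_simps)
qed

lemma norm_taylor_part_le:
  fixes f :: "complex^'n::{finite,linorder} \<Rightarrow> complex"
  assumes f: "continuous_on (Dom a) f" and z: "z \<in> Dom a"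
  shows "ennreal ((cmod (taylor_part f m z))\<^sup>2) \<le>
    (\<integral>\<^sup>+t. indicator {0..1} t * ennreal ((cmod (f (exp (2 * of_real pi * \<i> * of_real t) *s z)))\<^sup>2) \<partial>lborel)"
proof -
  let ?e = "\<lambda>t. exp (2 * of_real pi * \<i> * of_real t)"
  let ?g = "\<lambda>t. cmod (f (?e t *s z))"
  let ?p = "cmod (taylor_part f m z)"
  have g: "continuous_on {0..1} ?g"
    by (intro continuous_intros continuous_on_circle[OF f z])
  have int: "?g integrable_on {0..1}" "(\<lambda>t. (?g t)\<^sup>2) integrable_on {0..1}"
    by (intro integrable_continuous_real continuous_intros g)+
  have "?p \<le> integral {0..1} ?g"
    unfolding taylor_part_def
  proof (intro integral_norm_bound_integral)
    show "(\<lambda>t. f (?e t *s z) / ?e t ^ m) integrable_on {0..1}"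
      by (intro integrable_continuous_real continuous_intros continuous_on_circle[OF f z]) auto
  qed (use int in \<open>auto simp: norm_divide norm_power norm_exp_circle\<close>)
  \<comment> \<open>In place of Cauchy-Schwarz, 2pg \<le> p^2 + g^2 is integrated over t; the
    resulting p^2 cancels half of the left side.\<close>
  hence "2 * ?p * ?p \<le> 2 * ?p * integral {0..1} ?g" by (intro mult_left_mono) auto
  also have "\<dots> = integral {0..1} (\<lambda>t. 2 * ?p * ?g t)" by simp
  also have "\<dots> \<le> integral {0..1} (\<lambda>t. ?p\<^sup>2 + (?g t)\<^sup>2)"
    using int by (intro integral_le integrable_add integrable_on_mult_right) (auto simp: sum_squares_bound)
  also have "\<dots> = ?p\<^sup>2 + integral {0..1} (\<lambda>t. (?g t)\<^sup>2)"
    using int by (subst integral_add) auto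
  finally have "?p\<^sup>2 \<le> integral {0..1} (\<lambda>t. (?g t)\<^sup>2)" by (simp add: power2_eq_square)
  hence "ennreal (?p\<^sup>2) \<le> ennreal (integral {0..1} (\<lambda>t. (?g t)\<^sup>2))" by (rule ennreal_leI)
  also have "\<dots> = (\<integral>\<^sup>+t. indicator {0..1} t * ennreal ((?g t)\<^sup>2) \<partial>lborel)"
    using nn_integral_has_integral_lebesgue[OF _ integrable_integral[OF int(2)]]
    by (simp add: ennreal_mult' ennreal_indicator)
  finally show ?thesis .
qed

text \<open>Passing to a homogeneous part is a contraction in L2: after the pointwise bound and
  Fubini, the inner integral for each t is that of |f|^2 composed with a rotation, which does not
  exceed the original.\<close>

lemma nn_integral_taylor_part_le:
  fixes f :: "complex^'n::{finite,linorder} \<Rightarrow> complex"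
  assumes f: "continuous_on (Dom a) f"
  shows "(\<integral>\<^sup>+z. indicator (Dom a) z * ennreal ((cmod (taylor_part f m z))\<^sup>2) \<partial>lborel) \<le>
    (\<integral>\<^sup>+z. indicator (Dom a) z * ennreal ((cmod (f z))\<^sup>2) \<partial>lborel)" (is "_ \<le> ?K")
proof -
  let ?D = "Dom a :: (complex^'n::_) set"
  let ?e = "\<lambda>t::real. exp (2 * of_real pi * \<i> * of_real t)"
  \<comment> \<open>Extension of |f|^2 by zero, so that it is Borel measurable on the whole space
    and may be composed with rotations.\<close>
  define h where "h z = indicator ?D z *\<^sub>R (cmod (f z))\<^sup>2" for z
  have h [measurable]: "h \<in> borel_measurable borel"
    unfolding h_def by (intro borel_measurable_continuous_on_indicator continuous_intros f) simp
  have h0: "0 \<le> h z" for z by (simp add: h_def)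
  have hD: "ennreal (h z) = indicator ?D z * ennreal ((cmod (f z))\<^sup>2)" for z
    by (simp add: h_def indicator_def)
  have [measurable]: "(\<lambda>(z::complex^'n::_, t). ?e t *s z) \<in> borel_measurable (lborel \<Otimes>\<^sub>M lborel)"
  proof -
    have "continuous_on UNIV (\<lambda>(z::complex^'n::_, t). ?e t *s z)"
      by (auto simp: case_prod_unfold intro!: continuous_intros)
    hence "(\<lambda>(z::complex^'n::_, t). ?e t *s z) \<in> borel_measurable borel"
      by (rule borel_measurable_continuous_onI)
    thus ?thesis by (simp add: borel_prod[symmetric] measurable_lborel1 cong: measurable_cong_sets)
  qed
  have "(\<integral>\<^sup>+z. indicator ?D z * ennreal ((cmod (taylor_part f m z))\<^sup>2) \<partial>lborel) \<le>
      (\<integral>\<^sup>+z. \<integral>\<^sup>+t. indicator {0..1} t * ennreal (h (?e t *s z)) \<partial>lborel \<partial>lborel)"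
  proof (intro nn_integral_mono)
    fix z
    show "indicator ?D z * ennreal ((cmod (taylor_part f m z))\<^sup>2) \<le>
        (\<integral>\<^sup>+t. indicator {0..1} t * ennreal (h (?e t *s z)) \<partial>lborel)"
    proof (cases "z \<in> ?D")
      case True
      have "h (?e t *s z) = (cmod (f (?e t *s z)))\<^sup>2" for t
        using True by (simp add: h_def Dom_smult_unit norm_exp_circle)
      thus ?thesis using norm_taylor_part_le[OF f True, of m] True by simp
    qed simp
  qed
  also have "\<dots> = (\<integral>\<^sup>+t. \<integral>\<^sup>+z. indicator {0..1} t * ennreal (h (?e t *s z)) \<partial>lborel \<partial>lborel)"
    by (rule lborel_pair.Fubini'[symmetric]) measurable
  also have "\<dots> \<le> (\<integral>\<^sup>+t. indicator {0..1::real} t * ?K \<partial>lborel)"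
  proof (intro nn_integral_mono)
    fix t :: real
    let ?u = "(\<chi> i. ?e t) :: complex^'n::_"
    have u: "?u \<in> torus" by (simp add: torus_def norm_exp_circle)
    have rot: "rot ?u z = ?e t *s z" for z by (simp add: vec_eq_iff)
    have hz: "ennreal (h (?e t *s z)) = indicator ?D z * ennreal (h (rot ?u z))" for z
      using rot_in_Dom_iff[OF u, of z a] by (simp add: h_def rot indicator_def)
    have "(\<integral>\<^sup>+z. indicator {0..1} t * ennreal (h (?e t *s z)) \<partial>lborel) =
        indicator {0..1} t * (\<integral>\<^sup>+z. indicator ?D z * ennreal (h (rot ?u z)) \<partial>lborel)"
      unfolding hz by (rule nn_integral_cmult) measurable
    also have "\<dots> \<le> indicator {0..1} t * (\<integral>\<^sup>+z. indicator ?D z * ennreal (h z) \<partial>lborel)"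
      by (intro mult_left_mono nn_integral_rot_le u h h0) auto
    also have "(\<integral>\<^sup>+z. indicator ?D z * ennreal (h z) \<partial>lborel) = ?K"
      by (intro nn_integral_cong) (simp add: hD indicator_def)
    finally show "(\<integral>\<^sup>+z. indicator {0..1} t * ennreal (h (?e t *s z)) \<partial>lborel) \<le> indicator {0..1} t * ?K" .
  qed
  also have "\<dots> = ?K"
    by (subst nn_integral_multc) (auto simp: nn_integral_indicator)
  finally show ?thesis .
qed

section \<open>Vanishing of the Taylor coefficients of degree at least two\<close>

lemma compact_torus: "compact (torus :: (complex^'n::finite) set)"
proof -
  have "torus = (\<Inter>i. {u::complex^'n. cmod (u $ i) = 1})" by (auto simp: torus_def)
  also have "closed \<dots>"
    by (intro closed_INT ballI closed_Collect_eq continuous_intros)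
  finally have "closed (torus :: (complex^'n) set)" .
  moreover have "bounded (torus :: (complex^'n) set)"
  proof (rule boundedI)
    fix x :: "complex^'n" assume "x \<in> torus"
    thus "norm x \<le> real CARD('n)"
      using L2_set_le_sum[of UNIV "\<lambda>i. cmod (x $ i)"] by (simp add: norm_vec_def torus_def)
  qed
  ultimately show ?thesis by (simp add: compact_eq_bounded_closed)
qed

lemma torus_line_in_Dom: "u \<in> torus \<Longrightarrow> \<zeta> *s u \<in> Dom a"
  by (simp add: Dom_def torus_def norm_mult sq_norm_plus_1_pos[THEN less_imp_neq, symmetric])

lemma torus_in_Dom: "u \<in> torus \<Longrightarrow> u \<in> Dom a"
  using torus_line_in_Dom[of u 1 a] by simp

lemma dist_rot: "u \<in> torus \<Longrightarrow> dist (rot u z) (rot u w) = dist z w"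
proof -
  assume u: "u \<in> torus"
  have "dist (u $ i * z $ i) (u $ i * w $ i) = dist (z $ i) (w $ i)" for i
    using u by (simp add: dist_norm right_diff_distrib[symmetric] norm_mult torus_def)
  thus ?thesis by (simp add: dist_vec_def)
qed

lemma rot_scaleR: "rot u (r *\<^sub>R z) = r *\<^sub>R rot u z"
  by (simp add: vec_eq_iff)

text \<open>Far out the squared moduli of the coordinates differ from |z_n|^2 by less than 1. After
  division by |z_n| every coordinate has modulus within 1/R of 1, so normalising each one moves the
  point by at most n/R in total. This is how the torus describes the domain at infinity.\<close>

lemma Dom_near_torus:
  fixes z :: "complex^'n::{finite,linorder}"
  assumes a: "a > 0" and R: "R \<ge> 2" and z: "z \<in> Dom a" "R < cmod (z $ last_idx)"
  shows "\<exists>\<tau>\<in>torus. dist ((1 / cmod (z $ last_idx)) *\<^sub>R z) \<tau> \<le> real CARD('n) / R"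
proof -
  define \<rho> where "\<rho> = cmod (z $ last_idx)"
  have \<rho>: "\<rho> > R" "\<rho> > 0" using z R by (auto simp: \<rho>_def)
  define v where "v = (1 / \<rho>) *\<^sub>R z"
  have v: "\<bar>(cmod (v $ k))\<^sup>2 - 1\<bar> \<le> 1 / R" for k
  proof (cases "k = last_idx")
    case True
    thus ?thesis using \<rho> R by (simp add: v_def \<rho>_def[symmetric])
  next
    case False
    have "\<bar>(cmod (z $ k))\<^sup>2 - \<rho>\<^sup>2\<bar> < (\<rho>\<^sup>2 + 1) powr (- a)"
      using z False by (simp add: Dom_def \<rho>_def)
    also have "\<dots> \<le> (\<rho>\<^sup>2 + 1) powr 0" using a by (intro powr_mono) auto
    also have "\<dots> = 1" using sq_norm_plus_1_pos[of "z $ last_idx"] by (simp add: \<rho>_def)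
    finally have *: "\<bar>(cmod (z $ k))\<^sup>2 - \<rho>\<^sup>2\<bar> < 1" .
    have "\<bar>(cmod (v $ k))\<^sup>2 - 1\<bar> = \<bar>(cmod (z $ k))\<^sup>2 - \<rho>\<^sup>2\<bar> / \<rho>\<^sup>2"
    proof -
      have "(cmod (v $ k))\<^sup>2 - 1 = ((cmod (z $ k))\<^sup>2 - \<rho>\<^sup>2) / \<rho>\<^sup>2"
        using \<rho> by (simp add: v_def field_simps power_mult_distrib power_divide)
      thus ?thesis by (simp add: abs_divide)
    qed
    also have "\<dots> \<le> 1 / \<rho>\<^sup>2" using * \<rho> by (intro divide_right_mono) auto
    also have "\<dots> \<le> 1 / R"
    proof -
      have "R * 1 \<le> \<rho> * \<rho>" using \<rho> R by (intro mult_mono) auto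
      thus ?thesis using \<rho> R by (simp add: power2_eq_square divide_simps)
    qed
    finally show ?thesis .
  qed
  have pos: "cmod (v $ k) > 0" for k
  proof (rule ccontr)
    assume "\<not> ?thesis"
    hence "cmod (v $ k) = 0" by simp
    hence "1 \<le> 1 / R" using v[of k] by simp
    thus False using R by (simp add: divide_simps)
  qed
  define \<tau> where "\<tau> = (\<chi> k. v $ k / of_real (cmod (v $ k)))"
  have "\<tau> \<in> torus" using pos by (simp add: \<tau>_def torus_def norm_divide less_imp_neq[symmetric])
  moreover have "dist v \<tau> \<le> real CARD('n) / R"
  proof -
    have "norm ((v - \<tau>) $ k) \<le> 1 / R" for k
    proof -
      have "v $ k - \<tau> $ k = \<tau> $ k * of_real (cmod (v $ k) - 1)"
        using pos[of k] by (simp add: \<tau>_def field_simps)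
      hence "cmod ((v - \<tau>) $ k) = \<bar>cmod (v $ k) - 1\<bar>"
        using \<open>\<tau> \<in> torus\<close> by (simp add: norm_mult torus_def del: of_real_diff)
      \<comment> \<open>The extra factor is at least 1 and turns the distance into a difference of
        squares, which is what has been estimated.\<close>
      also have "\<dots> \<le> \<bar>cmod (v $ k) - 1\<bar> * (cmod (v $ k) + 1)"
        using mult_left_mono[of 1 "cmod (v $ k) + 1" "\<bar>cmod (v $ k) - 1\<bar>"] by simp
      also have "\<dots> = \<bar>(cmod (v $ k) - 1) * (cmod (v $ k) + 1)\<bar>" by (simp add: abs_mult)
      also have "\<dots> = \<bar>(cmod (v $ k))\<^sup>2 - 1\<bar>" by (simp add: power2_eq_square algebra_simps)
      finally show ?thesis using v[of k] by simp
    qed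
    hence "(\<Sum>k\<in>UNIV. norm ((v - \<tau>) $ k)) \<le> (\<Sum>k\<in>(UNIV::'n set). 1 / R)"
      by (rule sum_mono)
    moreover have "norm (v - \<tau>) \<le> (\<Sum>k\<in>UNIV. norm ((v - \<tau>) $ k))"
      unfolding norm_vec_def by (intro L2_set_le_sum) auto
    ultimately have "norm (v - \<tau>) \<le> (\<Sum>k\<in>(UNIV::'n set). 1 / R)" by linarith
    thus ?thesis by (simp add: dist_norm)
  qed
  ultimately show ?thesis unfolding v_def \<rho>_def by blast
qed

text \<open>If the Taylor coefficient were nonzero at one point of the torus, the square integral of
  \<open>\<bar>z\<^sub>n\<bar>\<^sup>m\<close> over a conical neighbourhood of the line through that point would be finite; finitely many
  rotated copies of this neighbourhood cover the domain near infinity.\<close>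

lemma taylor_coeff_vanishes:
  fixes f :: "complex^'n::{finite,linorder} \<Rightarrow> complex"
  assumes n2: "CARD('n) \<ge> 2" and a: "0 < a" "a \<le> 3 / (real CARD('n) - 1)"
    and f: "continuous_on (Dom a) f"
    and hol: "\<And>v. (\<lambda>\<zeta>. f (\<zeta> *s v)) holomorphic_on {\<zeta>. \<zeta> *s v \<in> Dom a}"
    and fin: "(\<integral>\<^sup>+z. indicator (Dom a) z * ennreal ((cmod (f z))\<^sup>2) \<partial>lborel) < \<infinity>"
    and u: "u \<in> torus" and m: "m \<ge> 2"
  shows "(deriv ^^ m) (\<lambda>\<zeta>. f (\<zeta> *s u)) 0 = 0"
proof (rule ccontr)
  assume neq: "(deriv ^^ m) (\<lambda>\<zeta>. f (\<zeta> *s u)) 0 \<noteq> 0"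
  let ?D = "Dom a :: (complex^'n::_) set" and ?l = "last_idx :: 'n"
  let ?P = "taylor_part f m"
  let ?q = "\<lambda>z::complex^'n::_. (1 / cmod (z $ ?l)) *\<^sub>R z"
  have "?P u \<noteq> 0"
    using taylor_part_scaleR[OF a(1) hol, of 1 u m] torus_in_Dom[OF u] neq by simp
  define c where "c = cmod (?P u) / 2"
  have c: "c > 0" using \<open>?P u \<noteq> 0\<close> by (simp add: c_def)
  obtain \<delta> where \<delta>: "\<delta> > 0" "\<And>v. v \<in> ?D \<Longrightarrow> dist v u < \<delta> \<Longrightarrow> dist (?P v) (?P u) < c"
    using continuous_on_taylor_part[OF f, of m] torus_in_Dom[OF u] c
    unfolding continuous_on_iff by blast
  have Pc: "c \<le> cmod (?P v)" if "v \<in> ?D" "dist v u < \<delta>" for v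
    using \<delta>(2)[OF that] norm_triangle_ineq2[of "?P u" "?P v"]
    by (simp add: c_def dist_norm norm_minus_commute)
  \<comment> \<open>\<open>?q\<close> rescales to a last coordinate of modulus 1, so the support of
    \<open>h\<close> is a cone around the line through u, cut off near the origin. The cut makes
    \<open>?q z\<close> a shrunken point of the domain; homogeneity then bounds
    |\<open>?P z\<close>| below by c |z_n|^m on the cone.\<close>
  define h where "h z = indicator {z. 1 < cmod (z $ ?l) \<and> dist (?q z) u < \<delta>} z * cmod (z $ ?l) ^ (2 * m)"
    for z :: "complex^'n::_"
  have h [measurable]: "h \<in> borel_measurable borel"
    unfolding h_def by measurable
  have h0: "h z \<ge> 0" for z by (simp add: h_def)
  have hfin: "(\<integral>\<^sup>+z. indicator ?D z * ennreal (h z) \<partial>lborel) < \<infinity>"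
  proof -
    have "(\<integral>\<^sup>+z. indicator ?D z * ennreal (h z) \<partial>lborel) \<le>
        (\<integral>\<^sup>+z. ennreal (1 / c\<^sup>2) * (indicator ?D z * ennreal ((cmod (?P z))\<^sup>2)) \<partial>lborel)"
    proof (intro nn_integral_mono)
      fix z
      show "indicator ?D z * ennreal (h z) \<le>
        ennreal (1 / c\<^sup>2) * (indicator ?D z * ennreal ((cmod (?P z))\<^sup>2))"
      proof (cases "z \<in> ?D \<and> 1 < cmod (z $ ?l) \<and> dist (?q z) u < \<delta>")
        case True
        let ?r = "cmod (z $ ?l)"
        have r: "?r > 1" "?r *\<^sub>R ?q z = z" and z0: "z $ ?l \<noteq> 0" using True by auto
        have "1 / ?r \<le> 1" by (subst divide_le_eq_1_pos) (use r(1) in linarith)+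
        hence qD: "?q z \<in> ?D" using True r by (intro Dom_scaleR[OF a(1)]) auto
        have "?P z = of_real ?r ^ m * ((deriv ^^ m) (\<lambda>\<zeta>. f (\<zeta> *s ?q z)) 0 / fact m)"
          using taylor_part_scaleR[OF a(1) hol, of ?r "?q z" m] True z0 by simp
        also have "(deriv ^^ m) (\<lambda>\<zeta>. f (\<zeta> *s ?q z)) 0 / fact m = ?P (?q z)"
          using taylor_part_scaleR[OF a(1) hol, of 1 "?q z" m] qD by simp
        finally have "(cmod (?P z))\<^sup>2 = ?r ^ (2 * m) * (cmod (?P (?q z)))\<^sup>2"
          by (simp add: norm_mult norm_power power_mult_distrib power_even_eq)
        moreover have "c\<^sup>2 \<le> (cmod (?P (?q z)))\<^sup>2"
          using Pc[OF qD] True c by (intro power_mono) auto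
        ultimately have "?r ^ (2 * m) * c\<^sup>2 \<le> (cmod (?P z))\<^sup>2"
          using r by (simp add: mult_left_mono)
        hence "?r ^ (2 * m) \<le> 1 / c\<^sup>2 * (cmod (?P z))\<^sup>2" using c by (simp add: field_simps)
        hence "ennreal (?r ^ (2 * m)) \<le> ennreal (1 / c\<^sup>2) * ennreal ((cmod (?P z))\<^sup>2)"
          by (subst ennreal_mult[symmetric]) (auto intro: ennreal_leI)
        thus ?thesis using True by (simp add: h_def)
      qed (auto simp: h_def indicator_def)
    qed
    also have "\<dots> = ennreal (1 / c\<^sup>2) * (\<integral>\<^sup>+z. indicator ?D z * ennreal ((cmod (?P z))\<^sup>2) \<partial>lborel)"
    proof (rule nn_integral_cmult)
      have "(\<lambda>z. indicator ?D z *\<^sub>R (cmod (?P z))\<^sup>2) \<in> borel_measurable borel"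
        by (intro borel_measurable_continuous_on_indicator continuous_intros continuous_on_taylor_part f) simp
      hence "(\<lambda>z. ennreal (indicator ?D z *\<^sub>R (cmod (?P z))\<^sup>2)) \<in> borel_measurable lborel" by simp
      also have "(\<lambda>z. ennreal (indicator ?D z *\<^sub>R (cmod (?P z))\<^sup>2)) = (\<lambda>z. indicator ?D z * ennreal ((cmod (?P z))\<^sup>2))"
        by (auto simp: indicator_def)
      finally show "(\<lambda>z. indicator ?D z * ennreal ((cmod (?P z))\<^sup>2)) \<in> borel_measurable lborel" .
    qed
    also have "\<dots> < \<infinity>"
      using order_le_less_trans[OF nn_integral_taylor_part_le[OF f] fin, of m]
      by (simp add: ennreal_mult_less_top)
    finally show ?thesis .
  qed
  have "torus \<subseteq> (\<Union>\<tau>\<in>torus. ball \<tau> (\<delta> / 2) :: (complex^'n::_) set)" using \<delta> by force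
  then obtain T where T: "T \<subseteq> torus" "finite T" "torus \<subseteq> (\<Union>\<tau>\<in>T. ball \<tau> (\<delta> / 2) :: (complex^'n::_) set)"
    using compactE_image[OF compact_torus, of torus "\<lambda>\<tau>. ball \<tau> (\<delta> / 2)"] by (metis open_ball)
  \<comment> \<open>Beyond \<open>R\<close> the rescaled point is within n/R < \<delta>/2 of the
    torus, hence within \<delta> of a point of the finite net \<open>T\<close>.\<close>
  define R where "R = max 2 (4 * real CARD('n) / \<delta>)"
  have R: "R \<ge> 2" "real CARD('n) / R < \<delta> / 2"
  proof -
    have "4 * real CARD('n) / \<delta> \<le> R" by (simp add: R_def)
    hence "4 * real CARD('n) \<le> R * \<delta>" using \<delta> by (simp add: field_simps)
    moreover show "R \<ge> 2" by (simp add: R_def)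
    moreover have "real CARD('n) > 0" by simp
    ultimately have "real CARD('n) * 2 < R * \<delta>" by linarith
    thus "real CARD('n) / R < \<delta> / 2" using \<open>R \<ge> 2\<close> by (simp add: field_simps)
  qed
  \<comment> \<open>The rotation that takes \<open>\<tau>\<close> to \<open>u\<close>, and with it
    the cone around \<open>\<tau>\<close> to the cone around \<open>u\<close>.\<close>
  define w where "w \<tau> = (\<chi> i. u $ i * cnj (\<tau> $ i))" for \<tau> :: "complex^'n::_"
  have w: "w \<tau> \<in> torus" "rot (w \<tau>) \<tau> = u" if "\<tau> \<in> torus" for \<tau>
    using that u
    by (simp_all add: w_def torus_def norm_mult vec_eq_iff complex_norm_square[symmetric] mult.assoc mult.commute[of "cnj _"])
  \<comment> \<open>Each far point lies in one of the rotated cones, where the corresponding summand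
    equals |z_n|^(2m). The divergent integral is thus bounded by finitely many finite ones.\<close>
  have "\<infinity> = (\<integral>\<^sup>+z. indicator (?D \<inter> {z. R < cmod (z $ ?l)}) z * ennreal (cmod (z $ ?l) ^ (2 * m)) \<partial>lborel)"
    using nn_integral_Dom_infinite[OF n2 a m, of R] R by simp
  also have "\<dots> \<le> (\<integral>\<^sup>+z. (\<Sum>\<tau>\<in>T. indicator ?D z * ennreal (h (rot (w \<tau>) z))) \<partial>lborel)"
  proof (intro nn_integral_mono)
    fix z :: "complex^'n::_"
    show "indicator (?D \<inter> {z. R < cmod (z $ ?l)}) z * ennreal (cmod (z $ ?l) ^ (2 * m))
      \<le> (\<Sum>\<tau>\<in>T. indicator ?D z * ennreal (h (rot (w \<tau>) z)))"
    proof (cases "z \<in> ?D \<and> R < cmod (z $ ?l)")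
      case True
      obtain \<sigma> where \<sigma>: "\<sigma> \<in> torus" "dist (?q z) \<sigma> \<le> real CARD('n) / R"
        using Dom_near_torus[OF a(1) R(1)] True by blast
      obtain \<tau> where \<tau>: "\<tau> \<in> T" "dist \<tau> \<sigma> < \<delta> / 2" using \<sigma> T by (auto simp: subset_iff)
      have "\<tau> \<in> torus" using \<tau> T by blast
      have "dist (?q z) \<tau> < \<delta>"
        using \<sigma>(2) \<tau>(2) R(2) dist_triangle2[of "?q z" \<tau> \<sigma>] by linarith
      moreover have cw: "cmod (rot (w \<tau>) z $ ?l) = cmod (z $ ?l)"
        using w(1)[OF \<open>\<tau> \<in> torus\<close>] by (simp add: norm_mult torus_def)
      hence "?q (rot (w \<tau>) z) = rot (w \<tau>) (?q z)" by (simp only: rot_scaleR)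
      hence "dist (?q (rot (w \<tau>) z)) u = dist (?q z) \<tau>"
        using dist_rot[OF w(1)[OF \<open>\<tau> \<in> torus\<close>], of "?q z" \<tau>] w(2)[OF \<open>\<tau> \<in> torus\<close>] by simp
      ultimately have "h (rot (w \<tau>) z) = cmod (z $ ?l) ^ (2 * m)"
        using True R cw by (simp add: h_def)
      hence "indicator (?D \<inter> {z. R < cmod (z $ ?l)}) z * ennreal (cmod (z $ ?l) ^ (2 * m)) =
          indicator ?D z * ennreal (h (rot (w \<tau>) z))" using True by simp
      also have "\<dots> \<le> (\<Sum>\<tau>\<in>T. indicator ?D z * ennreal (h (rot (w \<tau>) z)))"
        using \<tau> T by (intro member_le_sum) auto
      finally show ?thesis .
    qed auto
  qed
  also have "\<dots> = (\<Sum>\<tau>\<in>T. \<integral>\<^sup>+z. indicator ?D z * ennreal (h (rot (w \<tau>) z)) \<partial>lborel)"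
    by (rule nn_integral_sum) measurable
  also have "\<dots> \<le> (\<Sum>\<tau>\<in>T. \<integral>\<^sup>+z. indicator ?D z * ennreal (h z) \<partial>lborel)"
    using T w by (intro sum_mono nn_integral_rot_le h h0) auto
  also have "\<dots> < \<infinity>"
    using hfin by (simp add: ennreal_mult_less_top of_nat_less_top)
  finally show False by simp
qed

text \<open>The line through u lies in the domain, so the restriction is entire and equals its
  Taylor series, of which only the terms of degree 0 and 1 survive.\<close>

lemma affine_on_torus_lines:
  fixes f :: "complex^'n::{finite,linorder} \<Rightarrow> complex"
  assumes n2: "CARD('n) \<ge> 2" and a: "0 < a" "a \<le> 3 / (real CARD('n) - 1)"
    and f: "continuous_on (Dom a) f"
    and hol: "\<And>v. (\<lambda>\<zeta>. f (\<zeta> *s v)) holomorphic_on {\<zeta>. \<zeta> *s v \<in> Dom a}"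
    and fin: "(\<integral>\<^sup>+z. indicator (Dom a) z * ennreal ((cmod (f z))\<^sup>2) \<partial>lborel) < \<infinity>"
    and u: "u \<in> torus"
  shows "f (\<zeta> *s u) = f 0 + deriv (\<lambda>\<zeta>. f (\<zeta> *s u)) 0 * \<zeta>"
proof -
  let ?g = "\<lambda>\<zeta>. f (\<zeta> *s u)"
  have "?g holomorphic_on ball 0 (cmod \<zeta> + 1)"
    using hol[of u] torus_line_in_Dom[OF u] by (auto intro: holomorphic_on_subset)
  hence "(\<lambda>n. (deriv ^^ n) ?g 0 / fact n * (\<zeta> - 0) ^ n) sums ?g \<zeta>"
    by (rule holomorphic_power_series) auto
  moreover have "(\<lambda>n. (deriv ^^ n) ?g 0 / fact n * (\<zeta> - 0) ^ n) sums
      (\<Sum>n\<in>{..<2}. (deriv ^^ n) ?g 0 / fact n * (\<zeta> - 0) ^ n)"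
    using taylor_coeff_vanishes[OF n2 a f hol fin u] by (intro sums_finite) auto
  ultimately have "?g \<zeta> = (\<Sum>n\<in>{..<2}. (deriv ^^ n) ?g 0 / fact n * (\<zeta> - 0) ^ n)"
    by (rule sums_unique2)
  thus ?thesis by (simp add: numeral_2_eq_2)
qed

section \<open>The complex Jacobian and its regularity\<close>

text \<open>Entries are one-variable derivatives along the axes, so that Cauchy's formula applies to
  each of them.\<close>

definition jac :: "(complex^'n::finite \<Rightarrow> complex^'m::finite) \<Rightarrow> complex^'n \<Rightarrow> complex^'n^'m" where
  "jac F z = (\<chi> k j. deriv (\<lambda>\<zeta>. F (z + \<zeta> *s axis j 1) $ k) 0)"

lemma has_derivative_affine_line:
  "((\<lambda>\<zeta>. p + \<zeta> *s q) has_derivative (\<lambda>h. h *s q)) (at \<zeta>)"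
  for p q :: "complex^'n::finite"
proof -
  have "linear (\<lambda>h. h *s q)"
    by (intro linearI) (simp_all add: vec_eq_iff algebra_simps)
  hence "bounded_linear (\<lambda>h. h *s q)" by (simp add: linear_conv_bounded_linear)
  from bounded_linear_imp_has_derivative[OF this] show ?thesis
    by (auto intro!: derivative_eq_intros)
qed

text \<open>The derivative commutes with complex scalars, so it is determined by its values at the
  axis vectors.\<close>

lemma has_derivative_jac:
  assumes F: "cvec_holomorphic_on F S" and z: "z \<in> S"
  shows "(F has_derivative (\<lambda>v. jac F z *v v)) (at z)"
proof -
  obtain L where L: "(F has_derivative L) (at z)" "\<And>c v. L (c *s v) = c *s L v"
    using F z unfolding cvec_holomorphic_on_def by blast
  have lin: "linear L" using L(1) has_derivative_linear by blast
  have "jac F z $ k $ j = L (axis j 1) $ k" for k j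
  proof -
    have "((\<lambda>\<zeta>. F (z + \<zeta> *s axis j 1)) has_derivative (\<lambda>h. L (h *s axis j 1))) (at 0)"
      by (rule has_derivative_compose[OF has_derivative_affine_line]) (simp add: L(1))
    hence "((\<lambda>\<zeta>. F (z + \<zeta> *s axis j 1) $ k) has_derivative (\<lambda>h. L (h *s axis j 1) $ k)) (at 0)"
      by (rule bounded_linear.has_derivative[OF bounded_linear_vec_nth])
    hence "((\<lambda>\<zeta>. F (z + \<zeta> *s axis j 1) $ k) has_field_derivative L (axis j 1) $ k) (at 0)"
      by (rule has_derivative_imp_has_field_derivative) (simp add: L(2))
    thus ?thesis by (simp add: jac_def DERIV_imp_deriv)
  qed
  hence "L v = jac F z *v v" for v
  proof -
    assume *: "\<And>k j. jac F z $ k $ j = L (axis j 1) $ k"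
    have "v = (\<Sum>j\<in>UNIV. v $ j *s axis j 1)" by (simp add: basis_expansion)
    hence "L v = L (\<Sum>j\<in>UNIV. v $ j *s axis j 1)" by simp
    also have "\<dots> = (\<Sum>j\<in>UNIV. v $ j *s L (axis j 1))"
      by (simp only: linear_sum[OF lin] L(2))
    also have "\<dots> = jac F z *v v"
      by (simp add: vec_eq_iff matrix_vector_mult_def * mult.commute)
    finally show "L v = jac F z *v v" .
  qed
  hence "L = (\<lambda>v. jac F z *v v)" by blast
  thus ?thesis using L(1) by simp
qed

lemma cvec_holomorphic_imp_continuous_on:
  assumes "cvec_holomorphic_on F S"
  shows "continuous_on S F"
  using has_derivative_jac[OF assms] has_derivative_continuous continuous_at_imp_continuous_on by blast

lemma has_field_derivative_affine_line:
  assumes F: "cvec_holomorphic_on F S" and z: "p + \<zeta> *s q \<in> S"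
  shows "((\<lambda>\<zeta>. F (p + \<zeta> *s q) $ k) has_field_derivative (jac F (p + \<zeta> *s q) *v q) $ k) (at \<zeta>)"
proof -
  have "((\<lambda>\<zeta>. F (p + \<zeta> *s q)) has_derivative (\<lambda>h. jac F (p + \<zeta> *s q) *v (h *s q))) (at \<zeta>)"
    by (rule has_derivative_compose[OF has_derivative_affine_line has_derivative_jac[OF F z]])
  hence "((\<lambda>\<zeta>. F (p + \<zeta> *s q) $ k) has_derivative (\<lambda>h. (jac F (p + \<zeta> *s q) *v (h *s q)) $ k)) (at \<zeta>)"
    by (rule bounded_linear.has_derivative[OF bounded_linear_vec_nth])
  also have "(\<lambda>h. (jac F (p + \<zeta> *s q) *v (h *s q)) $ k) = (*) ((jac F (p + \<zeta> *s q) *v q) $ k)"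
    by (simp add: fun_eq_iff matrix_vector_mult_def sum_distrib_left sum_distrib_right mult_ac)
  finally show ?thesis by (simp add: has_field_derivative_def)
qed

lemma holomorphic_on_affine_line:
  assumes "cvec_holomorphic_on F S"
  shows "(\<lambda>\<zeta>. F (p + \<zeta> *s q) $ k) holomorphic_on {\<zeta>. p + \<zeta> *s q \<in> S}"
  unfolding holomorphic_on_def field_differentiable_def
  using has_field_derivative_at_within[OF has_field_derivative_affine_line[OF assms]] by blast

lemma norm_smult_axis: "norm (c *s axis j 1 :: complex^'n::finite) = cmod c"
proof -
  have "c *s axis j 1 = (axis j c :: complex^'n)" by (simp add: vec_eq_iff axis_def)
  thus ?thesis by (simp add: norm_eq_sqrt_inner inner_axis_axis)
qed

text \<open>\<open>cvec_holomorphic_on\<close> provides complex differentiability at each point but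
  no continuity of the derivative. In this Cauchy integral z enters only through F, with one radius
  for all z near \<open>z0\<close>; the doubled radius in the hypothesis leaves room for a circle of
  radius r about each such z.\<close>

lemma jac_eq_integral:
  fixes F :: "complex^'n::finite \<Rightarrow> complex^'m::finite"
  assumes F: "cvec_holomorphic_on F S" and r: "r > 0" "cball z0 (2 * r) \<subseteq> S" and z: "z \<in> ball z0 r"
  shows "jac F z $ k $ j = integral {0..1} (\<lambda>t. F (z + (of_real r * exp (2 * of_real pi * \<i> * of_real t)) *s axis j 1) $ k
    / exp (2 * of_real pi * \<i> * of_real t)) / of_real r"
proof -
  let ?g = "\<lambda>\<zeta>. F (z + \<zeta> *s axis j 1) $ k"
  let ?e = "\<lambda>t. exp (2 * of_real pi * \<i> * of_real t)"
  have "cball 0 r \<subseteq> {\<zeta>. z + \<zeta> *s axis j 1 \<in> S}"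
  proof
    fix \<zeta> :: complex assume "\<zeta> \<in> cball 0 r"
    hence "dist z0 (z + \<zeta> *s axis j 1) \<le> 2 * r"
      using z norm_triangle_ineq[of "z - z0" "\<zeta> *s axis j 1"]
      by (simp add: dist_norm norm_smult_axis norm_minus_commute algebra_simps)
    thus "\<zeta> \<in> {\<zeta>. z + \<zeta> *s axis j 1 \<in> S}" using r by auto
  qed
  hence "continuous_on (cball 0 r) ?g" "?g holomorphic_on ball 0 r"
    using holomorphic_on_affine_line[OF F, of z "axis j 1" k] ball_subset_cball
    by (blast intro: holomorphic_on_imp_continuous_on holomorphic_on_subset)+
  from Cauchy_contour_integral_circlepath_2[OF this, of 0] r
  have "2 * of_real pi * \<i> * deriv ?g 0 = contour_integral (circlepath 0 r) (\<lambda>u. ?g u / (u - 0)\<^sup>2)"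
    by simp
  also have "\<dots> = integral {0..1} (\<lambda>t. (2 * of_real pi * \<i> / of_real r) * (?g (of_real r * ?e t) / ?e t))"
    unfolding contour_integral_integral
  proof (intro integral_cong)
    fix t :: real
    have "circlepath 0 r t = of_real r * ?e t" by (simp add: circlepath)
    moreover have "vector_derivative (circlepath 0 r) (at t) = 2 * of_real pi * \<i> * of_real r * ?e t"
      by (simp add: vector_derivative_circlepath)
    ultimately show "?g (circlepath 0 r t) / (circlepath 0 r t - 0)\<^sup>2 *
        vector_derivative (circlepath 0 r) (at t) =
        (2 * of_real pi * \<i> / of_real r) * (?g (of_real r * ?e t) / ?e t)"
      using r by (simp add: power2_eq_square field_simps)
  qed
  also have "\<dots> = (2 * of_real pi * \<i> / of_real r) * integral {0..1} (\<lambda>t. ?g (of_real r * ?e t) / ?e t)"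
    by (rule integral_mult_right)
  finally show ?thesis using r by (simp add: jac_def field_simps)
qed

lemma circle_shift_in:
  fixes z0 :: "complex^'n::finite"
  assumes "r > 0" "cball z0 (2 * r) \<subseteq> S" "z \<in> ball z0 r"
  shows "z + (of_real r * exp (2 * of_real pi * \<i> * of_real t)) *s axis j 1 \<in> S"
proof -
  have "dist z0 (z + (of_real r * exp (2 * of_real pi * \<i> * of_real t)) *s axis j 1) \<le> 2 * r"
    using assms norm_triangle_ineq[of "z - z0" "(of_real r * exp (2 * of_real pi * \<i> * of_real t)) *s axis j 1"]
    by (simp add: dist_norm norm_smult_axis norm_minus_commute algebra_simps norm_mult norm_exp_circle)
  thus ?thesis using assms by auto
qed

lemma open_cball2:
  fixes z :: "'a::metric_space"
  assumes "open S" "z \<in> S"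
  obtains r where "r > 0" "cball z (2 * r) \<subseteq> S"
proof -
  obtain e where "e > 0" "cball z e \<subseteq> S" using assms open_contains_cball by blast
  thus ?thesis using that[of "e / 2"] by simp
qed

text \<open>A parameter integral of a continuous integrand, locally by
  \<open>jac_eq_integral\<close>.\<close>

lemma continuous_on_jac:
  fixes F :: "complex^'n::finite \<Rightarrow> complex^'m::finite"
  assumes F: "cvec_holomorphic_on F S"
  shows "continuous_on S (\<lambda>z. jac F z $ k $ j)"
proof (rule continuous_at_imp_continuous_on, rule ballI)
  fix z0 assume "z0 \<in> S"
  moreover have "open S" using F by (simp add: cvec_holomorphic_on_def)
  ultimately obtain r where r: "r > 0" "cball z0 (2 * r) \<subseteq> S" using open_cball2 by blast
  let ?e = "\<lambda>t. exp (2 * of_real pi * \<i> * of_real t)"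
  let ?f = "\<lambda>z t. F (z + (of_real r * ?e t) *s axis j 1) $ k / ?e t"
  have "continuous_on (ball z0 r \<times> cbox 0 1) (\<lambda>x. F (fst x + (of_real r * ?e (snd x)) *s axis j 1))"
    by (rule continuous_on_compose2[OF cvec_holomorphic_imp_continuous_on[OF F]])
       (auto intro!: continuous_intros circle_shift_in[OF r])
  hence "continuous_on (ball z0 r \<times> cbox 0 1) (\<lambda>(z, t). ?f z t)"
    by (auto simp: case_prod_unfold intro!: continuous_intros)
  from integral_continuous_on_param[OF this]
  have "continuous_on (ball z0 r) (\<lambda>z. integral {0..1} (?f z) / of_real r)"
    using r by (auto intro!: continuous_intros)
  hence "continuous_on (ball z0 r) (\<lambda>z. jac F z $ k $ j)"
    by (rule continuous_on_eq) (simp add: jac_eq_integral[OF F r])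
  thus "isCont (\<lambda>z. jac F z $ k $ j) z0"
    using r by (simp add: continuous_on_eq_continuous_at)
qed

text \<open>Differentiation under the Cauchy integral. The Leibniz rule requires the differentiated
  integrand to be jointly continuous; since it involves the Jacobian again, this rests on
  \<open>continuous_on_jac\<close>.\<close>

lemma holomorphic_on_jac_line:
  fixes F :: "complex^'n::finite \<Rightarrow> complex^'m::finite"
  assumes F: "cvec_holomorphic_on F S"
  shows "(\<lambda>\<zeta>. jac F (\<zeta> *s v) $ k $ j) holomorphic_on {\<zeta>. \<zeta> *s v \<in> S}"
proof -
  have oS: "open S" using F by (simp add: cvec_holomorphic_on_def)
  have cl: "continuous_on UNIV (\<lambda>\<zeta>. \<zeta> *s v)" by (intro continuous_intros)
  have "\<exists>g. open g \<and> \<zeta>0 \<in> g \<and> (\<lambda>\<zeta>. jac F (\<zeta> *s v) $ k $ j) holomorphic_on g"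
    if \<zeta>0: "\<zeta>0 *s v \<in> S" for \<zeta>0
  proof -
    obtain r where r: "r > 0" "cball (\<zeta>0 *s v) (2 * r) \<subseteq> S" using open_cball2[OF oS \<zeta>0] by blast
    have "open ((\<lambda>\<zeta>. \<zeta> *s v) -` ball (\<zeta>0 *s v) r)"
      by (rule open_vimage[OF _ cl]) simp
    then obtain \<epsilon> where \<epsilon>: "\<epsilon> > 0" "ball \<zeta>0 \<epsilon> \<subseteq> (\<lambda>\<zeta>. \<zeta> *s v) -` ball (\<zeta>0 *s v) r"
      using r by (metis centre_in_ball open_contains_ball vimageI)
    let ?e = "\<lambda>t. exp (2 * of_real pi * \<i> * of_real t)"
    let ?s = "\<lambda>t. (of_real r * ?e t) *s axis j 1 :: complex^'n"
    have inS: "\<zeta> *s v + ?s t \<in> S" if "\<zeta> \<in> ball \<zeta>0 \<epsilon>" for \<zeta> t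
      using that \<epsilon> by (intro circle_shift_in[OF r]) auto
    have "(\<lambda>\<zeta>. integral (cbox 0 1) (\<lambda>t. F (\<zeta> *s v + ?s t) $ k / ?e t)) holomorphic_on ball \<zeta>0 \<epsilon>"
    proof (rule leibniz_rule_holomorphic)
      fix \<zeta> :: complex and t :: real assume \<zeta>: "\<zeta> \<in> ball \<zeta>0 \<epsilon>"
      have "((\<lambda>\<zeta>. F (?s t + \<zeta> *s v) $ k) has_field_derivative (jac F (?s t + \<zeta> *s v) *v v) $ k) (at \<zeta>)"
        using inS[OF \<zeta>] by (intro has_field_derivative_affine_line[OF F]) (simp add: add.commute)
      from DERIV_cdivide[OF this, of "?e t"]
      show "((\<lambda>\<zeta>. F (\<zeta> *s v + ?s t) $ k / ?e t) has_field_derivative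
          (jac F (\<zeta> *s v + ?s t) *v v) $ k / ?e t) (at \<zeta> within ball \<zeta>0 \<epsilon>)"
        by (simp add: add.commute has_field_derivative_at_within)
    next
      fix \<zeta> assume \<zeta>: "\<zeta> \<in> ball \<zeta>0 \<epsilon>"
      have "continuous_on (cbox 0 1) (\<lambda>t. F (\<zeta> *s v + ?s t))"
        by (rule continuous_on_compose2[OF cvec_holomorphic_imp_continuous_on[OF F]])
           (auto intro!: continuous_intros inS \<zeta>)
      thus "(\<lambda>t. F (\<zeta> *s v + ?s t) $ k / ?e t) integrable_on cbox 0 1"
        by (intro integrable_continuous continuous_intros) auto
    next
      have "continuous_on (ball \<zeta>0 \<epsilon> \<times> cbox 0 1) (\<lambda>x. jac F (fst x *s v + ?s (snd x)) $ k $ i)" for i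
        by (rule continuous_on_compose2[OF continuous_on_jac[OF F]])
           (auto intro!: continuous_intros inS)
      note c = this
      show "continuous_on (ball \<zeta>0 \<epsilon> \<times> cbox 0 1) (\<lambda>(\<zeta>, t). (jac F (\<zeta> *s v + ?s t) *v v) $ k / ?e t)"
        unfolding case_prod_unfold matrix_vector_mult_def vec_lambda_beta
        by (intro continuous_on_divide continuous_on_sum continuous_on_mult c continuous_on_const)
           (auto intro!: continuous_intros)
    qed simp
    hence "(\<lambda>\<zeta>. integral {0..1} (\<lambda>t. F (\<zeta> *s v + ?s t) $ k / ?e t) / of_real r) holomorphic_on ball \<zeta>0 \<epsilon>"
      using r by (auto intro!: holomorphic_intros)
    hence "(\<lambda>\<zeta>. jac F (\<zeta> *s v) $ k $ j) holomorphic_on ball \<zeta>0 \<epsilon>"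
      by (rule holomorphic_transform) (use \<epsilon> in \<open>auto simp: subset_iff jac_eq_integral[OF F r]\<close>)
    thus ?thesis using \<epsilon> by (intro exI[of _ "ball \<zeta>0 \<epsilon>"]) auto
  qed
  thus ?thesis
    by (metis (no_types, lifting) holomorphic_on_def field_differentiable_at_within holomorphic_on_imp_differentiable_at mem_Collect_eq)
qed

lemma continuous_on_det_jac:
  fixes F :: "complex^'n::finite \<Rightarrow> complex^'n"
  assumes F: "cvec_holomorphic_on F S"
  shows "continuous_on S (\<lambda>z. det (jac F z))"
  unfolding det_def by (intro continuous_intros continuous_on_jac[OF F])

lemma holomorphic_on_det_jac_line:
  fixes F :: "complex^'n::finite \<Rightarrow> complex^'n"
  assumes F: "cvec_holomorphic_on F S"
  shows "(\<lambda>\<zeta>. det (jac F (\<zeta> *s v))) holomorphic_on {\<zeta>. \<zeta> *s v \<in> S}"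
  unfolding det_def by (intro holomorphic_intros holomorphic_on_jac_line[OF F])

section \<open>The image of the origin\<close>

text \<open>The torus spans C^n: the all-ones vector and the one with the sign of entry j flipped
  differ by twice the j-th axis vector.\<close>

lemma torus_span_zero:
  fixes c :: "'n::finite \<Rightarrow> complex"
  assumes "\<And>u. u \<in> torus \<Longrightarrow> (\<Sum>j\<in>UNIV. c j * u $ j) = 0"
  shows "c j = 0"
proof -
  let ?u = "(\<chi> i. if i = j then -1 else 1) :: complex^'n"
  have "(\<Sum>i\<in>UNIV. c i * (\<chi> i. 1) $ i) = 0" "(\<Sum>i\<in>UNIV. c i * ?u $ i) = 0"
    by (intro assms; simp add: torus_def)+
  hence "(\<Sum>i\<in>UNIV. c i - c i * (if i = j then -1 else 1)) = 0"
    by (simp add: sum_subtractf)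
  also have "(\<Sum>i\<in>UNIV. c i - c i * (if i = j then -1 else 1)) = (\<Sum>i\<in>UNIV. if i = j then 2 * c i else 0)"
    by (intro sum.cong) auto
  finally show ?thesis by simp
qed

text \<open>The expression is a real quadratic polynomial in \<zeta> whose odd part is 2 Re(c
  \<zeta>), with c the difference of the two products. A bounded function has bounded odd part, and
  a bounded real-linear function is zero.\<close>

lemma bounded_difference_of_squares:
  assumes bnd: "\<And>\<zeta>::complex. \<bar>(cmod (b + \<zeta> * y))\<^sup>2 - (cmod (b' + \<zeta> * y'))\<^sup>2\<bar> \<le> 1"
  shows "cnj b * y = cnj b' * y'"
proof (rule ccontr)
  define c where "c = cnj b * y - cnj b' * y'"
  assume "cnj b * y \<noteq> cnj b' * y'"
  hence c: "(cmod c)\<^sup>2 > 0" by (simp add: c_def)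
  define q where "q \<zeta> = (cmod (b + \<zeta> * y))\<^sup>2 - (cmod (b' + \<zeta> * y'))\<^sup>2" for \<zeta>
  have q: "q \<zeta> - q (- \<zeta>) = 4 * Re (c * \<zeta>)" for \<zeta>
    unfolding q_def c_def cmod_power2 by (simp add: power2_eq_square algebra_simps)
  \<comment> \<open>This is 1/c, at which the values at \<zeta> and -\<zeta> differ by 4, while the
    bound permits only 2.\<close>
  let ?\<zeta> = "of_real (1 / (cmod c)\<^sup>2) * cnj c"
  have "c * ?\<zeta> = 1"
    using c by (simp add: complex_norm_square[symmetric] mult.left_commute[of c] del: of_real_power)
  hence "q ?\<zeta> - q (- ?\<zeta>) = 4" using q[of ?\<zeta>] by simp
  moreover have "\<bar>q ?\<zeta>\<bar> \<le> 1" "\<bar>q (- ?\<zeta>)\<bar> \<le> 1" unfolding q_def by (rule bnd)+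
  ultimately show False by linarith
qed

text \<open>In \<open>Dom a\<close> the squared moduli of the coordinates differ by less than 1, so
  boundedness along each line applies. As the torus spans C^n, it yields equal multiples cnj(b_k)
  and cnj(b_n) of two different rows of A. Rows of an invertible matrix are independent, so all
  these multiples vanish.\<close>

lemma affine_image_in_Dom_centered:
  fixes A :: "complex^'n::{finite,linorder}^'n::{finite,linorder}" and b :: "complex^'n::{finite,linorder}"
  assumes n2: "CARD('n) \<ge> 2" and a: "a > 0" and A: "invertible A"
    and img: "\<And>u \<zeta>. u \<in> torus \<Longrightarrow> b + \<zeta> *s (A *v u) \<in> Dom a"
  shows "b = 0"
proof -
  let ?l = "last_idx :: 'n"
  have rows: "cnj (b $ k) * A $ k $ j = cnj (b $ ?l) * A $ ?l $ j" if k: "k \<noteq> ?l" for k j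
  proof -
    have "cnj (b $ k) * (A *v u) $ k = cnj (b $ ?l) * (A *v u) $ ?l" if u: "u \<in> torus" for u
    proof (rule bounded_difference_of_squares)
      fix \<zeta> :: complex
      let ?z = "b + \<zeta> *s (A *v u)"
      have "\<bar>(cmod (?z $ k))\<^sup>2 - (cmod (?z $ ?l))\<^sup>2\<bar> < ((cmod (?z $ ?l))\<^sup>2 + 1) powr (- a)"
        using img[OF u, of \<zeta>] k unfolding Dom_def by blast
      also have "\<dots> \<le> ((cmod (?z $ ?l))\<^sup>2 + 1) powr 0" using a by (intro powr_mono) auto
      also have "\<dots> = 1" using sq_norm_plus_1_pos[of "?z $ ?l"] by simp
      finally show "\<bar>(cmod (b $ k + \<zeta> * (A *v u) $ k))\<^sup>2 - (cmod (b $ ?l + \<zeta> * (A *v u) $ ?l))\<^sup>2\<bar> \<le> 1"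
        by simp
    qed
    hence "(\<Sum>j\<in>UNIV. (cnj (b $ k) * A $ k $ j - cnj (b $ ?l) * A $ ?l $ j) * u $ j) = 0"
      if "u \<in> torus" for u
      using that by (simp add: matrix_vector_mult_def sum_distrib_left left_diff_distrib sum_subtractf mult.assoc)
    from torus_span_zero[of "\<lambda>j. cnj (b $ k) * A $ k $ j - cnj (b $ ?l) * A $ ?l $ j", OF this]
    show ?thesis by simp
  qed
  \<comment> \<open>Multiplying a relation between rows by the right inverse turns rows of A into
    unit vectors, from which the coefficients are read off.\<close>
  obtain B where B: "A ** B = mat 1" using A by (auto simp: invertible_def)
  have AB: "(\<Sum>j\<in>UNIV. A $ i $ j * B $ j $ i') = (if i = i' then 1 else 0)" for i i'
    using arg_cong[OF B, of "\<lambda>M. M $ i $ i'"] by (simp add: matrix_matrix_mult_def mat_def)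
  have eq: "cnj (b $ k) * (if k = i then 1 else 0) = cnj (b $ ?l) * (if ?l = i then 1 else 0)"
    if k: "k \<noteq> ?l" for k i
  proof -
    have "cnj (b $ k) * (\<Sum>j\<in>UNIV. A $ k $ j * B $ j $ i) = (\<Sum>j\<in>UNIV. (cnj (b $ k) * A $ k $ j) * B $ j $ i)"
      by (simp add: sum_distrib_left mult.assoc)
    also have "\<dots> = cnj (b $ ?l) * (\<Sum>j\<in>UNIV. A $ ?l $ j * B $ j $ i)"
      by (simp add: rows[OF k] sum_distrib_left mult.assoc)
    finally show ?thesis unfolding AB .
  qed
  have bk: "b $ k = 0" if "k \<noteq> ?l" for k
    using eq[OF that, of k] that by auto
  have "\<exists>k. k \<noteq> ?l"
  proof (rule ccontr)
    assume "\<nexists>k. k \<noteq> ?l"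
    hence "(UNIV :: 'n set) = {?l}" by auto
    hence "CARD('n) = 1" by (metis card_1_singleton_iff One_nat_def)
    thus False using n2 by simp
  qed
  then obtain k where "k \<noteq> ?l" by blast
  hence "b $ ?l = 0" using eq[of k ?l] by auto
  thus ?thesis using bk by (metis vec_eq_iff zero_index)
qed

section \<open>An identity theorem from the torus lines\<close>

text \<open>The maximum principle, one coordinate at a time: the induction over \<open>I\<close>
  frees the coordinates in \<open>I\<close> to move inside their discs, while the others remain on
  the boundary circles.\<close>

lemma zero_on_polydisc:
  fixes g :: "complex^'n::finite \<Rightarrow> complex"
  assumes \<rho>: "\<rho> > 0" "\<And>z. (\<forall>i. cmod (z $ i) \<le> \<rho>) \<Longrightarrow> z \<in> S"
    and hol: "\<And>p q. (\<lambda>\<zeta>. g (p + \<zeta> *s q)) holomorphic_on {\<zeta>. p + \<zeta> *s q \<in> S}"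
    and zero: "\<And>z. \<forall>i. cmod (z $ i) = \<rho> \<Longrightarrow> g z = 0"
    and z: "\<forall>i. cmod (z $ i) \<le> \<rho>"
  shows "g z = 0"
proof -
  have "\<forall>z. (\<forall>i\<in>I. cmod (z $ i) \<le> \<rho>) \<and> (\<forall>i\<in>-I. cmod (z $ i) = \<rho>) \<longrightarrow> g z = 0" for I :: "'n set"
    using finite[of I]
  proof (induction I)
    case empty
    then show ?case using zero by simp
  next
    case (insert i I)
    show ?case
    proof (intro allI impI)
      fix z :: "complex^'n"
      assume z: "(\<forall>j\<in>insert i I. cmod (z $ j) \<le> \<rho>) \<and> (\<forall>j\<in>-insert i I. cmod (z $ j) = \<rho>)"
      \<comment> \<open>The point with coordinate i erased, so that \<zeta> alone runs through that
        coordinate.\<close>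
      define p where "p = (\<chi> j. if j = i then 0 else z $ j)"
      have nth: "(p + \<zeta> *s axis i 1) $ j = (if j = i then \<zeta> else z $ j)" for \<zeta> j
        by (simp add: p_def axis_def)
      have sub: "cball 0 \<rho> \<subseteq> {\<zeta>. p + \<zeta> *s axis i 1 \<in> S}"
      proof
        fix \<zeta> :: complex assume "\<zeta> \<in> cball 0 \<rho>"
        have "cmod ((p + \<zeta> *s axis i 1) $ j) \<le> \<rho>" for j
          using z \<open>\<zeta> \<in> cball 0 \<rho>\<close> unfolding nth by (cases "j \<in> insert i I") auto
        thus "\<zeta> \<in> {\<zeta>. p + \<zeta> *s axis i 1 \<in> S}" using \<rho> by blast
      qed
      let ?\<phi> = "\<lambda>\<zeta>. g (p + \<zeta> *s axis i 1)"
      have hb: "?\<phi> holomorphic_on cball 0 \<rho>" using hol sub holomorphic_on_subset by blast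
      have "cmod (?\<phi> (z $ i)) \<le> 0"
      proof (rule maximum_modulus_frontier[of ?\<phi> "cball 0 \<rho>"])
        show "?\<phi> holomorphic_on interior (cball 0 \<rho>)"
          using hb interior_subset holomorphic_on_subset by blast
        show "continuous_on (closure (cball 0 \<rho>)) ?\<phi>"
          using hb holomorphic_on_imp_continuous_on by simp
        show "z $ i \<in> cball 0 \<rho>" using z by simp
        fix \<zeta> :: complex assume "\<zeta> \<in> frontier (cball 0 \<rho>)"
        hence "cmod \<zeta> = \<rho>" using \<rho> by simp
        hence "g (p + \<zeta> *s axis i 1) = 0"
          using z \<open>i \<notin> I\<close> by (intro insert.IH[rule_format]) (auto simp only: nth split: if_splits)
        thus "cmod (?\<phi> \<zeta>) \<le> 0" by simp
      qed simp
      moreover have "p + (z $ i) *s axis i 1 = z" unfolding vec_eq_iff nth by simp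
      ultimately show "g z = 0" by simp
    qed
  qed
  from this[of UNIV] z show ?thesis by simp
qed

text \<open>The torus scaled by \<rho> is the distinguished boundary of a small polydisc, so g
  vanishes on that polydisc. One-variable continuation along the line from 0 to z, which meets the
  balanced domain in a disc, carries this to z.\<close>

lemma zero_on_Dom:
  fixes g :: "complex^'n::{finite,linorder} \<Rightarrow> complex"
  assumes a: "a > 0"
    and hol: "\<And>p q. (\<lambda>\<zeta>. g (p + \<zeta> *s q)) holomorphic_on {\<zeta>. p + \<zeta> *s q \<in> Dom a}"
    and zero: "\<And>u \<zeta>. u \<in> torus \<Longrightarrow> g (\<zeta> *s u) = 0" and z: "z \<in> Dom a"
  shows "g z = 0"
proof -
  let ?D = "Dom a :: (complex^'n::_) set"
  have "0 \<in> ?D" by (simp add: Dom_def)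
  then obtain \<epsilon> where \<epsilon>: "\<epsilon> > 0" "ball 0 \<epsilon> \<subseteq> ?D" using open_Dom open_contains_ball by blast
  \<comment> \<open>Bounding the norm by the sum of the n moduli puts the closed polydisc of this
    radius inside the \<epsilon>-ball.\<close>
  define \<rho> where "\<rho> = \<epsilon> / (2 * real CARD('n))"
  have \<rho>: "\<rho> > 0" using \<epsilon> by (simp add: \<rho>_def)
  have in_D: "z \<in> ?D" if "\<forall>i. cmod (z $ i) \<le> \<rho>" for z
  proof -
    have "norm z \<le> (\<Sum>i\<in>UNIV. cmod (z $ i))"
      unfolding norm_vec_def by (intro L2_set_le_sum) auto
    also have "\<dots> \<le> (\<Sum>i\<in>(UNIV::'n set). \<rho>)" using that by (intro sum_mono) auto
    also have "\<dots> = \<epsilon> / 2" by (simp add: \<rho>_def)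
    also have "\<dots> < \<epsilon>" using \<epsilon> by simp
    finally show ?thesis using \<epsilon> by (auto simp: dist_norm)
  qed
  have poly: "g z = 0" if "\<forall>i. cmod (z $ i) \<le> \<rho>" for z
  proof (rule zero_on_polydisc[OF \<rho> in_D hol _ that])
    fix w :: "complex^'n::_" assume w: "\<forall>i. cmod (w $ i) = \<rho>"
    let ?u = "(\<chi> i. w $ i / of_real \<rho>) :: complex^'n::_"
    have "?u \<in> torus" using w \<rho> by (simp add: torus_def norm_divide)
    hence "g (of_real \<rho> *s ?u) = 0" by (rule zero)
    moreover have "of_real \<rho> *s ?u = w" using \<rho> by (simp add: vec_eq_iff)
    ultimately show "g w = 0" by simp
  qed
  have cl: "continuous_on UNIV (\<lambda>\<zeta>. \<zeta> *s z)" by (intro continuous_intros)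
  have "open ((\<lambda>\<zeta>. \<zeta> *s z) -` ?D)" by (rule open_vimage[OF open_Dom cl])
  moreover have "1 \<in> (\<lambda>\<zeta>. \<zeta> *s z) -` ?D" using z by simp
  ultimately obtain e where e: "e > 0" "ball 1 e \<subseteq> (\<lambda>\<zeta>. \<zeta> *s z) -` ?D"
    using open_contains_ball by blast
  \<comment> \<open>Slightly more than 1, so that the open disc of radius r contains the point 1
    corresponding to z and still stays in the domain.\<close>
  define r where "r = 1 + e / 2"
  have r: "r > 1" using e by (simp add: r_def)
  have "of_real r \<in> ball (1::complex) e" using e by (simp add: r_def dist_norm)
  hence rz: "of_real r *s z \<in> ?D" using e by auto
  have sub: "ball 0 r \<subseteq> {\<zeta>. 0 + \<zeta> *s z \<in> ?D}"
  proof
    fix \<zeta> :: complex assume "\<zeta> \<in> ball 0 r"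
    hence "cmod (\<zeta> / of_real r) \<le> 1" using r by (simp add: norm_divide)
    from Dom_smult[OF a rz this] r show "\<zeta> \<in> {\<zeta>. 0 + \<zeta> *s z \<in> ?D}" by simp
  qed
  \<comment> \<open>Small enough that \<zeta> z stays in the polydisc for |\<zeta>| < \<sigma>. The
    1 in the denominator covers z = 0, and \<sigma> \<le> 1 keeps this disc inside the one of radius
    r.\<close>
  define \<sigma> where "\<sigma> = min 1 (\<rho> / (norm z + 1))"
  have nz: "norm z + 1 > 0" by (rule add_nonneg_pos) auto
  have "\<sigma> \<le> \<rho> / (norm z + 1)" by (simp add: \<sigma>_def)
  hence \<sigma>: "\<sigma> * (norm z + 1) \<le> \<rho>" "\<sigma> > 0" "\<sigma> \<le> 1"
    using \<rho> nz by (simp add: pos_le_divide_eq, simp_all add: \<sigma>_def)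
  have small: "g (0 + \<zeta> *s z) = 0" if "\<zeta> \<in> ball 0 \<sigma>" for \<zeta>
  proof (simp, rule poly, rule allI)
    fix i
    have "cmod \<zeta> * cmod (z $ i) \<le> \<sigma> * (norm z + 1)"
      using that Finite_Cartesian_Product.norm_nth_le[of z i] \<sigma> by (intro mult_mono) auto
    thus "cmod ((\<zeta> *s z) $ i) \<le> \<rho>" using \<sigma> by (simp add: norm_mult)
  qed
  have "(\<lambda>\<zeta>. g (0 + \<zeta> *s z)) 1 = (\<lambda>_. 0) (1::complex)"
  proof (rule analytic_continuation_open[where s = "ball 0 \<sigma>" and s' = "ball 0 r"
        and f = "\<lambda>\<zeta>. g (0 + \<zeta> *s z)" and g = "\<lambda>_. 0"])
    show "(\<lambda>\<zeta>. g (0 + \<zeta> *s z)) holomorphic_on ball 0 r"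
      using hol sub holomorphic_on_subset by blast
  qed (use \<sigma> r small in \<open>auto intro: order_less_le_trans\<close>)
  thus ?thesis by simp
qed

section \<open>Linearity of the biholomorphism\<close>

text \<open>Naming the matrix and recording its invertibility allows both claims of the theorem, the
  linearity of F and the linear equivalence, to be read off.\<close>

lemma biholomorphism_Dom_linear:
  fixes F :: "complex^'n::{finite,linorder} \<Rightarrow> complex^'n::{finite,linorder}"
  assumes n2: "CARD('n) \<ge> 2"
    and a1: "2 / (real CARD('n) - 1) < a1" "a1 \<le> 3 / (real CARD('n) - 1)"
    and a2: "2 / (real CARD('n) - 1) < a2"
    and bi: "biholomorphism F (Dom a1) (Dom a2)"
  shows "invertible (jac F 0) \<and> (\<forall>z\<in>Dom a1. F z = jac F 0 *v z)"
proof -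
  let ?D1 = "Dom a1 :: (complex^'n::_) set" and ?D2 = "Dom a2 :: (complex^'n::_) set"
  let ?J = "\<lambda>z. det (jac F z)" and ?l = "last_idx :: 'n"
  have "0 < 2 / (real CARD('n) - 1)" using n2 by simp
  hence pos: "a1 > 0" "a2 > 0" using a1 a2 by linarith+
  obtain G where F: "cvec_holomorphic_on F ?D1" and bij: "bij_betw F ?D1 ?D2"
    and G: "cvec_holomorphic_on G ?D2" and GF: "\<And>z. z \<in> ?D1 \<Longrightarrow> G (F z) = z"
    using bi unfolding biholomorphism_def by blast
  have img: "F ` ?D1 = ?D2" and inj: "inj_on F ?D1" using bij by (auto simp: bij_betw_def)
  note contF = cvec_holomorphic_imp_continuous_on[OF F]
  have inv: "invertible (jac F z)" if z: "z \<in> ?D1" for z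
  proof -
    have Fz: "F z \<in> ?D2" using img z by blast
    have "((\<lambda>x. G (F x)) has_derivative (\<lambda>v. jac G (F z) *v (jac F z *v v))) (at z)"
      by (rule has_derivative_compose[OF has_derivative_jac[OF F z] has_derivative_jac[OF G Fz]])
    hence "((\<lambda>x. x) has_derivative (\<lambda>v. jac G (F z) *v (jac F z *v v))) (at z)"
      by (rule has_derivative_transform_within_open[OF _ open_Dom z GF])
    hence "(\<lambda>v. jac G (F z) *v (jac F z *v v)) = (\<lambda>v. v)"
      by (rule has_derivative_unique) (rule has_derivative_ident)
    hence "jac G (F z) ** jac F z = mat 1"
      by (simp add: matrix_eq matrix_vector_mul_assoc fun_eq_iff)
    thus ?thesis using invertible_left_inverse by blast
  qed
  have J0: "?J z \<noteq> 0" if "z \<in> ?D1" for z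
    using inv[OF that] by (simp add: invertible_det_nz)
  have fin2: "(\<integral>\<^sup>+z. indicator ?D2 z * ennreal ((cmod (z $ ?l))\<^sup>2 + 1) \<partial>lborel) < \<infinity>"
    by (rule nn_integral_Dom_finite[OF n2 a2])
  \<comment> \<open>The pullback for both choices of \<open>h\<close> that occur, the constant 1 and
    a coordinate; each is dominated by the weight of \<open>nn_integral_Dom_finite\<close> on the
    target.\<close>
  have L2: "(\<integral>\<^sup>+z. indicator ?D1 z * ennreal ((cmod (h (F z) * ?J z))\<^sup>2) \<partial>lborel) < \<infinity>"
    if h: "continuous_on UNIV h" and bd: "\<And>w. w \<in> ?D2 \<Longrightarrow> (cmod (h w))\<^sup>2 \<le> (cmod (w $ ?l))\<^sup>2 + 1"
    for h :: "complex^'n::_ \<Rightarrow> complex"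
  proof -
    have "(\<integral>\<^sup>+z. indicator ?D1 z * ennreal ((cmod (?J z))\<^sup>2 * (cmod (h (F z)))\<^sup>2) \<partial>lborel)
        \<le> (\<integral>\<^sup>+w. indicator (F ` ?D1) w * ennreal ((cmod (h w))\<^sup>2) \<partial>lborel)"
    proof (rule nn_change_of_variables_complex)
      show "(\<lambda>w. (cmod (h w))\<^sup>2) \<in> borel_measurable borel"
        by (intro borel_measurable_continuous_onI continuous_intros h)
      have hF: "continuous_on ?D1 (\<lambda>z. h (F z))"
        by (rule continuous_on_compose2[OF h contF]) auto
      have "(\<lambda>z. indicator ?D1 z *\<^sub>R ((cmod (?J z))\<^sup>2 * (cmod (h (F z)))\<^sup>2)) \<in> borel_measurable borel"
        by (intro borel_measurable_continuous_on_indicator continuous_intros continuous_on_det_jac[OF F] hF) simp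
      hence "(\<lambda>z. ennreal (indicator ?D1 z *\<^sub>R ((cmod (?J z))\<^sup>2 * (cmod (h (F z)))\<^sup>2))) \<in> borel_measurable borel"
        by simp
      also have "(\<lambda>z. ennreal (indicator ?D1 z *\<^sub>R ((cmod (?J z))\<^sup>2 * (cmod (h (F z)))\<^sup>2))) =
          (\<lambda>z. indicator ?D1 z * ennreal ((cmod (?J z))\<^sup>2 * (cmod (h (F z)))\<^sup>2))"
        by (auto simp: indicator_def)
      finally show "(\<lambda>z. indicator ?D1 z * ennreal ((cmod (?J z))\<^sup>2 * (cmod (h (F z)))\<^sup>2)) \<in> borel_measurable borel" .
    qed (use open_Dom inj img has_derivative_jac[OF F] in auto)
    also have "\<dots> \<le> (\<integral>\<^sup>+z. indicator ?D2 z * ennreal ((cmod (z $ ?l))\<^sup>2 + 1) \<partial>lborel)"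
      using bd by (intro nn_integral_mono) (auto simp: img indicator_def simp del: ennreal_plus intro!: ennreal_leI)
    also note fin2
    finally show ?thesis by (simp add: norm_mult power_mult_distrib mult.commute)
  qed
  have holF: "(\<lambda>\<zeta>. F (\<zeta> *s v) $ k) holomorphic_on {\<zeta>. \<zeta> *s v \<in> ?D1}" for v k
    using holomorphic_on_affine_line[OF F, of 0 v k] by simp
  note holJ = holomorphic_on_det_jac_line[OF F]
  have affJ: "?J (\<zeta> *s u) = ?J 0 + deriv (\<lambda>\<zeta>. ?J (\<zeta> *s u)) 0 * \<zeta>" if u: "u \<in> torus" for u \<zeta>
    using L2[of "\<lambda>_. 1"]
    by (intro affine_on_torus_lines[OF n2 pos(1) a1(2) continuous_on_det_jac[OF F] holJ _ u]) auto
  have J_const: "?J (\<zeta> *s u) = ?J 0" if u: "u \<in> torus" for u \<zeta>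
  proof -
    let ?c = "deriv (\<lambda>\<zeta>. ?J (\<zeta> *s u)) 0"
    have "?c = 0"
    proof (rule ccontr)
      assume "?c \<noteq> 0"
      hence "?J ((- ?J 0 / ?c) *s u) = 0" using affJ[OF u, of "- ?J 0 / ?c"] by simp
      thus False using J0[OF torus_line_in_Dom[OF u]] by blast
    qed
    thus ?thesis using affJ[OF u, of \<zeta>] by simp
  qed
  have zD: "0 \<in> ?D1" by (simp add: Dom_def)
  have affF: "F (\<zeta> *s u) = F 0 + \<zeta> *s (jac F 0 *v u)" if u: "u \<in> torus" for u \<zeta>
  proof -
    have "F (\<zeta> *s u) $ k = F 0 $ k + \<zeta> * (jac F 0 *v u) $ k" for k
    proof -
      let ?f = "\<lambda>z. F z $ k * ?J z"

      have bd: "(cmod (w $ k))\<^sup>2 \<le> (cmod (w $ ?l))\<^sup>2 + 1" if w: "w \<in> ?D2" for w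
      proof (cases "k = ?l")
        case False
        have "\<bar>(cmod (w $ k))\<^sup>2 - (cmod (w $ ?l))\<^sup>2\<bar> < ((cmod (w $ ?l))\<^sup>2 + 1) powr (- a2)"
          using w False by (simp add: Dom_def)
        also have "\<dots> \<le> ((cmod (w $ ?l))\<^sup>2 + 1) powr 0" using pos by (intro powr_mono) auto
        also have "\<dots> = 1" using sq_norm_plus_1_pos[of "w $ ?l"] by simp
        finally show ?thesis by linarith
      qed simp
      have "?f (\<zeta> *s u) = ?f 0 + deriv (\<lambda>\<zeta>. ?f (\<zeta> *s u)) 0 * \<zeta>" for \<zeta>
      proof (rule affine_on_torus_lines[OF n2 pos(1) a1(2) _ _ _ u])
        show "continuous_on ?D1 ?f"
          by (intro continuous_intros contF continuous_on_det_jac[OF F])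
        show "(\<lambda>\<zeta>. ?f (\<zeta> *s v)) holomorphic_on {\<zeta>. \<zeta> *s v \<in> ?D1}" for v
          by (intro holomorphic_intros holF holJ)
        show "(\<integral>\<^sup>+z. indicator ?D1 z * ennreal ((cmod (?f z))\<^sup>2) \<partial>lborel) < \<infinity>"
          using bd by (intro L2[of "\<lambda>w. w $ k"] continuous_intros) auto
      qed
      then obtain d where "\<And>\<zeta>. ?f (\<zeta> *s u) = ?f 0 + d * \<zeta>" by blast
      hence d: "F (\<zeta> *s u) $ k * ?J 0 = F 0 $ k * ?J 0 + d * \<zeta>" for \<zeta>
        by (metis J_const[OF u])
      define c where "c = d / ?J 0"
      have "F (\<zeta> *s u) $ k * ?J 0 = F 0 $ k * ?J 0 + (c * \<zeta>) * ?J 0" for \<zeta>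
        unfolding d c_def using J0[OF zD] by simp
      hence aff: "F (\<zeta> *s u) $ k = F 0 $ k + c * \<zeta>" for \<zeta>
        using J0[OF zD] by (simp only: distrib_right[symmetric] mult_cancel_right) simp
      \<comment> \<open>So far the slope c is only known for the line at hand. Identifying it with a
        directional derivative at 0 shows that it depends linearly on u, through one matrix for all
        lines.\<close>
      have "((\<lambda>\<zeta>. F (0 + \<zeta> *s u) $ k) has_field_derivative (jac F (0 + 0 *s u) *v u) $ k) (at 0)"
        by (rule has_field_derivative_affine_line[OF F]) (simp add: zD)
      hence "((\<lambda>\<zeta>. F 0 $ k + c * \<zeta>) has_field_derivative (jac F 0 *v u) $ k) (at 0)"
        by (simp add: aff)
      moreover have "((\<lambda>\<zeta>. F 0 $ k + c * \<zeta>) has_field_derivative c) (at 0)"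
        by (auto intro!: derivative_eq_intros)
      ultimately have "c = (jac F 0 *v u) $ k" by (rule DERIV_unique[symmetric])
      thus ?thesis using aff by simp
    qed
    thus ?thesis by (simp add: vec_eq_iff)
  qed
  have "F 0 = 0"
  proof (rule affine_image_in_Dom_centered[OF n2 pos(2) inv[OF zD]])
    fix u :: "complex^'n::_" and \<zeta> :: complex assume "u \<in> torus"
    thus "F 0 + \<zeta> *s (jac F 0 *v u) \<in> ?D2"
      using img torus_line_in_Dom[of u \<zeta> a1] by (auto simp flip: affF)
  qed
  have "F z = jac F 0 *v z" if z: "z \<in> ?D1" for z
  proof -
    have "F z $ k - (jac F 0 *v z) $ k = 0" for k
    proof (rule zero_on_Dom[OF pos(1) _ _ z, of "\<lambda>z. F z $ k - (jac F 0 *v z) $ k"])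
      show "(\<lambda>\<zeta>. F (p + \<zeta> *s q) $ k - (jac F 0 *v (p + \<zeta> *s q)) $ k) holomorphic_on
          {\<zeta>. p + \<zeta> *s q \<in> ?D1}" for p q
      proof (intro holomorphic_on_diff holomorphic_on_affine_line[OF F])
        show "(\<lambda>\<zeta>. (jac F 0 *v (p + \<zeta> *s q)) $ k) holomorphic_on {\<zeta>. p + \<zeta> *s q \<in> ?D1}"
          by (simp add: matrix_vector_mult_def) (intro holomorphic_intros)
      qed
      fix u :: "complex^'n::_" and \<zeta> :: complex assume "u \<in> torus"
      thus "F (\<zeta> *s u) $ k - (jac F 0 *v (\<zeta> *s u)) $ k = 0"
        by (simp add: affF \<open>F 0 = 0\<close> matrix_vector_mult_def sum_distrib_left mult_ac)
    qed
    thus ?thesis by (simp add: vec_eq_iff)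
  qed
  thus ?thesis using inv[OF zD] by blast
qed

theorem theorem4p4:
  fixes a1 a2 :: real
  assumes n2: "CARD('n::{finite,linorder}) \<ge> 2"
    and a1: "2 / (real CARD('n::{finite,linorder}) - 1) < a1" "a1 \<le> 3 / (real CARD('n::{finite,linorder}) - 1)"
    and a2: "2 / (real CARD('n::{finite,linorder}) - 1) < a2" "a2 \<le> 3 / (real CARD('n::{finite,linorder}) - 1)"
  shows "(\<forall>F. biholomorphism F (Dom a1 :: (complex ^ 'n::{finite,linorder}) set) (Dom a2) \<longrightarrow>
            (\<exists>A :: complex ^ 'n::{finite,linorder} ^ 'n::{finite,linorder}. \<forall>z\<in>Dom a1. F z = A *v z))
         \<and> (biholomorphically_equivalent (Dom a1 :: (complex ^ 'n::{finite,linorder}) set) (Dom a2) \<longrightarrow>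
            linearly_equivalent (Dom a1 :: (complex ^ 'n::{finite,linorder}) set) (Dom a2))"
proof (intro conjI allI impI)
  note lin = biholomorphism_Dom_linear[OF n2 a1 a2(1)]
  show "\<exists>A. \<forall>z\<in>Dom a1. F z = A *v z"
    if "biholomorphism F (Dom a1 :: (complex ^ 'n::_) set) (Dom a2)" for F
    using lin[OF that] by blast
  assume "biholomorphically_equivalent (Dom a1 :: (complex ^ 'n::_) set) (Dom a2)"
  then obtain F where F: "biholomorphism F (Dom a1 :: (complex ^ 'n::_) set) (Dom a2)"
    unfolding biholomorphically_equivalent_def by blast
  have "(\<lambda>z. jac F 0 *v z) ` Dom a1 = F ` Dom a1"
    using lin[OF F] by (intro image_cong) auto
  also have "\<dots> = Dom a2"
    using F by (simp add: biholomorphism_def bij_betw_def)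
  finally show "linearly_equivalent (Dom a1 :: (complex ^ 'n::_) set) (Dom a2)"
    unfolding linearly_equivalent_def using lin[OF F] by blast
qed

end
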